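(* Let $F^m,\Psi^0_{\mathbf h}\in H_{\mathbf h}$ for any $m\ge 1$. Then there exists a unique solution to the splitting in potential scheme on the infinite space mesh (described in the context) such that $\Psi^m\in H_{\mathbf h}$ for any $m\ge 0$, and the following stability bound holds: $$\max_{0\le m\le M}\|\sqrt{\rho_{\mathbf h}}\,\Psi^m\|_{H_{\mathbf h}}\le\|\sqrt{\rho_{\mathbf h}}\,\Psi^0_{\mathbf h}\|_{H_{\mathbf h}}+\frac2\hbar\sum_{m=1}^M\Bigl\|\frac{F^m}{\sqrt{\rho_{\mathbf h}}}\Bigr\|_{H_{\mathbf h}}\tau_m\quad\text{for any } M\ge 1.$$ Moreover, in the particular case $F=0$, the mass conservation law holds: $$\|\sqrt{\rho_{\mathbf h}}\,\Psi^m\|_{H_{\mathbf h}}^2=\|\sqrt{\rho_{\mathbf h}}\,\Psi^0_{\mathbf h}\|_{H_{\mathbf h}}^2\quad\text{for any } m\ge1.$$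
   Context: **Coefficients.** $\Omega=(0,\infty)\times(0,Y)$, $\Omega_X=(0,X)\times(0,Y)$, $\hbar>0$ constant. Real functions $\rho(x,y)\ge\underline\rho>0$, $V(x,y)$ and a real symmetric matrix $\mathbf B=\{B_{pq}(x,y)\}_{p,q=1}^2$, positive definite uniformly in $\Omega$, are given. For some $X_0>0$, on $\Omega\setminus\Omega_{X_0}$: $B_{11}=B_{1\infty}>0$, $B_{12}=B_{21}=0$, $B_{22}=B_{2\infty}>0$, $\rho=\rho_\infty>0$, $V=V_\infty$ (constants). A real auxiliary potential $\widetilde V(x)$ satisfies $\widetilde V(x)=V_\infty$ for $x\ge X_0$. **Meshes.** $\overline\omega^{\,\tau}$: nodes $0=t_0<t_1<\dots$, $t_m\to\infty$, $\tau_m=t_m-t_{m-1}$. In $x$: $\overline\omega_{h,\infty}$ with nodes $0=x_0<\dots<x_J=X<\dots$ on $[0,\infty)$, where $X>X_0$, with $h_j=x_j-x_{j-1}$, $x_{J-2}\ge X_0$, $h_j=h:=h_J$ for $j\ge J$; $h_{j+1/2}=\frac{h_j+h_{j+1}}2$; $\omega_{h,\infty}=\overline\omega_{h,\infty}\setminus\{0\}$. In $y$: $\overline\omega_\delta$ with nodes $0=y_0<\dots<y_K=Y$, $\delta_k=y_k-y_{k-1}$, $\delta_{k+1/2}=\frac{\delta_k+\delta_{k+1}}2$, $\omega_\delta=\{y_k\}_{k=1}^{K-1}$. $\overline\omega_{\mathbf h,\infty}=\overline\omega_{h,\infty}\times\overline\omega_\delta$, $\omega_{\mathbf h,\infty}=\omega_{h,\infty}\times\omega_\delta$,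 $\Gamma_{\mathbf h,\infty}=\overline\omega_{\mathbf h,\infty}\setminus\omega_{\mathbf h,\infty}$. **Mesh operators.** $\overline\partial_xW_j=\frac{W_j-W_{j-1}}{h_j}$, $\widehat\partial_xW_j=\frac{W_{j+1}-W_j}{h_{j+1/2}}$, $\overline s_xW_j=\frac{W_{j-1}+W_j}2$, $\widehat s_xW_j=\frac{h_jW_j+h_{j+1}W_{j+1}}{2h_{j+1/2}}$; $\overline\partial_y,\widehat\partial_y,\overline s_y,\widehat s_y$ are defined likewise in the index $k$ with steps $\delta_k,\delta_{k+1/2}$. **Discrete coefficients.** $A_{-,jk}=A(\frac{x_{j-1}+x_j}2,\frac{y_{k-1}+y_k}2)$ for $A=\rho,B_{pq},V$ and $\widetilde V_{-,j}=\widetilde V(\frac{x_{j-1}+x_j}2)$; $B_{11\mathbf h}=\widehat s_yB_{11,-}$, $B_{22\mathbf h}=\widehat s_xB_{22,-}$, $B_{12\mathbf h}=B_{21\mathbf h}=B_{12,-}$, $\rho_{\mathbf h}=\widehat s_x\widehat s_y\rho_-$, $V_{\mathbf h}=\widehat s_x\widehat s_yV_-$, $\widetilde V_h=\widehat s_x\widetilde V_-$, $\Delta V_{\mathbf h}=V_{\mathbf h}-\widetilde V_h$. The mesh Hamiltonian is $$\mathcal H_{0\mathbf h}W=-\tfrac{\hbar^2}2\bigl[\widehat\partial_x(B_{11\mathbf h}\overline\partial_xW)+\widehat\partial_x\widehat s_y(B_{12\mathbf h}\overline s_x\overline\partial_yW)+\widehat s_x\widehat\partial_y(B_{21\mathbf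 h}\overline\partial_x\overline s_yW)+\widehat\partial_y(B_{22\mathbf h}\overline\partial_yW)\bigr].$$ **Space $H_{\mathbf h}$.** The Hilbert space of mesh functions $W:\overline\omega_{\mathbf h,\infty}\to\mathbb C$ with $W|_{\Gamma_{\mathbf h,\infty}}=0$ and $\sum_{j=1}^\infty\sum_{k=1}^{K-1}|W_{jk}|^2\delta_{k+1/2}<\infty$, with inner product $(U,W)_{H_{\mathbf h}}=\sum_{j=1}^\infty\sum_{k=1}^{K-1}U_{jk}W_{jk}^*h_{j+1/2}\delta_{k+1/2}$ and associated norm ($*$ is complex conjugation). **Scheme on the infinite mesh.** Given $F^m$ ($m\ge1$) and $\Psi^0_{\mathbf h}$ on $\overline\omega_{\mathbf h,\infty}$ (with $F^m|_{\Gamma_{\mathbf h,\infty}}=0$), find $\Psi^0=\Psi^0_{\mathbf h}$ and, for all $m\ge1$, functions $\breve\Psi^m,\widetilde\Psi^m,\Psi^m$ on $\overline\omega_{\mathbf h,\infty}$, vanishing on $\Gamma_{\mathbf h,\infty}$, such that on $\omega_{\mathbf h,\infty}$: (i) $\breve\Psi^m=\mathcal E^m\Psi^{m-1}$; (ii) $i\hbar\rho_{\mathbf h}\dfrac{\widetilde\Psi^m-\breve\Psi^m}{\tau_m}=(\mathcal H_{0\mathbf h}+\widetilde V_h)\dfrac{\widetilde\Psi^m+\breve\Psi^m}2+F^m$; (iii) $\Psi^m=\mathcal E^m\widetilde\Psi^m$; where either $\mathcal E^m=\dfrac{1-i\frac{\tau_m}{4\hbar\rho_{\mathbf h}}\Delta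 V_{\mathbf h}}{1+i\frac{\tau_m}{4\hbar\rho_{\mathbf h}}\Delta V_{\mathbf h}}$ (so (i), (iii) are equivalent to $i\hbar\rho_{\mathbf h}\frac{\breve\Psi^m-\Psi^{m-1}}{\tau_m/2}=\Delta V_{\mathbf h}\frac{\breve\Psi^m+\Psi^{m-1}}2$ and $i\hbar\rho_{\mathbf h}\frac{\Psi^m-\widetilde\Psi^m}{\tau_m/2}=\Delta V_{\mathbf h}\frac{\Psi^m+\widetilde\Psi^m}2$), or $\mathcal E^m=\exp\{-i\frac{\tau_m}{2\hbar\rho_{\mathbf h}}\Delta V_{\mathbf h}\}$ (both choices are admitted). *)

theory Defs
  imports "HOL-Analysis.Analysis"
begin

definition strip :: "real \<Rightarrow> (real \<times> real) set" where
  "strip Y = {0<..} \<times> {0<..<Y}"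

definition strip_upto :: "real \<Rightarrow> real \<Rightarrow> (real \<times> real) set" where
  "strip_upto X Y = {0<..<X} \<times> {0<..<Y}"

(* A one-dimensional mesh is its sequence of nodes s 0 < s 1 < ...; step s j is meaningful
   for j >= 1 only. *)

definition step :: "(nat \<Rightarrow> real) \<Rightarrow> nat \<Rightarrow> real" where
  "step s j = s j - s (j - 1)"

definition half_step :: "(nat \<Rightarrow> real) \<Rightarrow> nat \<Rightarrow> real" where
  "half_step s j = (step s j + step s (j + 1)) / 2"

definition bwd_diff :: "(nat \<Rightarrow> real) \<Rightarrow> (nat \<Rightarrow> 'a::real_vector) \<Rightarrow> nat \<Rightarrow> 'a" where
  "bwd_diff s w j = (w j - w (j - 1)) /\<^sub>R step s j"

definition fwd_diff :: "(nat \<Rightarrow> real) \<Rightarrow> (nat \<Rightarrow> 'a::real_vector) \<Rightarrow> nat \<Rightarrow> 'a" where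
  "fwd_diff s w j = (w (j + 1) - w j) /\<^sub>R half_step s j"

definition bwd_avg :: "(nat \<Rightarrow> 'a::real_vector) \<Rightarrow> nat \<Rightarrow> 'a" where
  "bwd_avg w j = (w (j - 1) + w j) /\<^sub>R 2"

definition fwd_avg :: "(nat \<Rightarrow> real) \<Rightarrow> (nat \<Rightarrow> 'a::real_vector) \<Rightarrow> nat \<Rightarrow> 'a" where
  "fwd_avg s w j =
     (step s j *\<^sub>R w j + step s (j + 1) *\<^sub>R w (j + 1)) /\<^sub>R (2 * half_step s j)"

(* A mesh function W has the value W j k at the node (x j, y k).  Only the values with k <= K are
   values at nodes; those with k > K are immaterial. *)

definition in_x ::
  "((nat \<Rightarrow> 'a) \<Rightarrow> nat \<Rightarrow> 'b) \<Rightarrow> (nat \<Rightarrow> nat \<Rightarrow> 'a) \<Rightarrow> nat \<Rightarrow> nat \<Rightarrow> 'b" where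
  "in_x L W j k = L (\<lambda>i. W i k) j"

definition in_y ::
  "((nat \<Rightarrow> 'a) \<Rightarrow> nat \<Rightarrow> 'b) \<Rightarrow> (nat \<Rightarrow> nat \<Rightarrow> 'a) \<Rightarrow> nat \<Rightarrow> nat \<Rightarrow> 'b" where
  "in_y L W j k = L (\<lambda>l. W j l) k"

definition pw_scale ::
  "(nat \<Rightarrow> nat \<Rightarrow> real) \<Rightarrow> (nat \<Rightarrow> nat \<Rightarrow> 'a::real_vector) \<Rightarrow> nat \<Rightarrow> nat \<Rightarrow> 'a" where
  "pw_scale c W j k = c j k *\<^sub>R W j k"

definition cell_mid ::
  "(nat \<Rightarrow> real) \<Rightarrow> (nat \<Rightarrow> real) \<Rightarrow> (real \<times> real \<Rightarrow> real) \<Rightarrow> nat \<Rightarrow> nat \<Rightarrow> real" where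
  "cell_mid x y A j k = A ((x (j - 1) + x j) / 2, (y (k - 1) + y k) / 2)"

(* Used for both rho_h and V_h. *)
definition cell_avg ::
  "(nat \<Rightarrow> real) \<Rightarrow> (nat \<Rightarrow> real) \<Rightarrow> (real \<times> real \<Rightarrow> real) \<Rightarrow> nat \<Rightarrow> nat \<Rightarrow> real" where
  "cell_avg x y A = in_x (fwd_avg x) (in_y (fwd_avg y) (cell_mid x y A))"

definition aux_pot :: "(nat \<Rightarrow> real) \<Rightarrow> (real \<Rightarrow> real) \<Rightarrow> nat \<Rightarrow> real" where
  "aux_pot x Vt = fwd_avg x (\<lambda>j. Vt ((x (j - 1) + x j) / 2))"

definition pot_diff ::
  "(nat \<Rightarrow> real) \<Rightarrow> (nat \<Rightarrow> real) \<Rightarrow> (real \<times> real \<Rightarrow> real) \<Rightarrow> (real \<Rightarrow> real)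
    \<Rightarrow> nat \<Rightarrow> nat \<Rightarrow> real" where
  "pot_diff x y V Vt j k = cell_avg x y V j k - aux_pot x Vt j"

definition mesh_hamiltonian ::
  "real \<Rightarrow> (nat \<Rightarrow> real) \<Rightarrow> (nat \<Rightarrow> real) \<Rightarrow> (real \<times> real \<Rightarrow> real^2^2)
    \<Rightarrow> (nat \<Rightarrow> nat \<Rightarrow> complex) \<Rightarrow> nat \<Rightarrow> nat \<Rightarrow> complex" where
  "mesh_hamiltonian hbar x y B W j k =
    (let B11 = in_y (fwd_avg y) (cell_mid x y (\<lambda>z. B z $ 1 $ 1));
         B12 = cell_mid x y (\<lambda>z. B z $ 1 $ 2);
         B21 = cell_mid x y (\<lambda>z. B z $ 2 $ 1);
         B22 = in_x (fwd_avg x) (cell_mid x y (\<lambda>z. B z $ 2 $ 2))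
     in - (hbar\<^sup>2 / 2) *\<^sub>R
       (in_x (fwd_diff x) (pw_scale B11 (in_x (bwd_diff x) W)) j k
        + in_x (fwd_diff x) (in_y (fwd_avg y)
            (pw_scale B12 (in_x bwd_avg (in_y (bwd_diff y) W)))) j k
        + in_x (fwd_avg x) (in_y (fwd_diff y)
            (pw_scale B21 (in_x (bwd_diff x) (in_y bwd_avg W)))) j k
        + in_y (fwd_diff y) (pw_scale B22 (in_y (bwd_diff y) W)) j k))"

definition zero_on_boundary :: "nat \<Rightarrow> (nat \<Rightarrow> nat \<Rightarrow> complex) \<Rightarrow> bool" where
  "zero_on_boundary K W \<longleftrightarrow> (\<forall>j. \<forall>k\<le>K. j = 0 \<or> k = 0 \<or> k = K \<longrightarrow> W j k = 0)"

definition mesh_eq :: "nat \<Rightarrow> (nat \<Rightarrow> nat \<Rightarrow> complex) \<Rightarrow> (nat \<Rightarrow> nat \<Rightarrow> complex) \<Rightarrow> bool" where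
  "mesh_eq K U W \<longleftrightarrow> (\<forall>j. \<forall>k\<le>K. U j k = W j k)"

definition H_space :: "(nat \<Rightarrow> real) \<Rightarrow> nat \<Rightarrow> (nat \<Rightarrow> nat \<Rightarrow> complex) set" where
  "H_space y K = {W. zero_on_boundary K W \<and>
     (\<lambda>j. \<Sum>k\<in>{1..<K}. (cmod (W j k))\<^sup>2 * half_step y k) summable_on {1..}}"

definition H_inner ::
  "(nat \<Rightarrow> real) \<Rightarrow> (nat \<Rightarrow> real) \<Rightarrow> nat \<Rightarrow> (nat \<Rightarrow> nat \<Rightarrow> complex) \<Rightarrow> (nat \<Rightarrow> nat \<Rightarrow> complex)
    \<Rightarrow> complex" where
  "H_inner x y K U W =
     (\<Sum>\<^sub>\<infinity>j\<in>{1..}. \<Sum>k\<in>{1..<K}.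
        U j k * cnj (W j k) * of_real (half_step x j) * of_real (half_step y k))"

definition H_norm ::
  "(nat \<Rightarrow> real) \<Rightarrow> (nat \<Rightarrow> real) \<Rightarrow> nat \<Rightarrow> (nat \<Rightarrow> nat \<Rightarrow> complex) \<Rightarrow> real" where
  "H_norm x y K W = sqrt (Re (H_inner x y K W W))"

(* The two admissible choices of the potential propagator over half a time step; dV and r stand for
   the mesh functions Delta V_h and rho_h. *)

definition propag_rational ::
  "real \<Rightarrow> (nat \<Rightarrow> real) \<Rightarrow> (nat \<Rightarrow> nat \<Rightarrow> real) \<Rightarrow> (nat \<Rightarrow> nat \<Rightarrow> real)
    \<Rightarrow> nat \<Rightarrow> nat \<Rightarrow> nat \<Rightarrow> complex" where
  "propag_rational hbar t r dV m j k =
     (1 - \<i> * of_real (step t m / (4 * hbar * r j k) * dV j k)) /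
     (1 + \<i> * of_real (step t m / (4 * hbar * r j k) * dV j k))"

definition propag_exp ::
  "real \<Rightarrow> (nat \<Rightarrow> real) \<Rightarrow> (nat \<Rightarrow> nat \<Rightarrow> real) \<Rightarrow> (nat \<Rightarrow> nat \<Rightarrow> real)
    \<Rightarrow> nat \<Rightarrow> nat \<Rightarrow> nat \<Rightarrow> complex" where
  "propag_exp hbar t r dV m j k =
     exp (- \<i> * of_real (step t m / (2 * hbar * r j k) * dV j k))"

definition scheme_solution ::
  "real \<Rightarrow> (real \<times> real \<Rightarrow> real) \<Rightarrow> (real \<times> real \<Rightarrow> real^2^2) \<Rightarrow> (real \<Rightarrow> real)
    \<Rightarrow> (nat \<Rightarrow> real) \<Rightarrow> (nat \<Rightarrow> real) \<Rightarrow> (nat \<Rightarrow> real) \<Rightarrow> nat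
    \<Rightarrow> (nat \<Rightarrow> nat \<Rightarrow> nat \<Rightarrow> complex) \<Rightarrow> (nat \<Rightarrow> nat \<Rightarrow> nat \<Rightarrow> complex) \<Rightarrow> (nat \<Rightarrow> nat \<Rightarrow> complex)
    \<Rightarrow> (nat \<Rightarrow> nat \<Rightarrow> nat \<Rightarrow> complex) \<Rightarrow> (nat \<Rightarrow> nat \<Rightarrow> nat \<Rightarrow> complex)
    \<Rightarrow> (nat \<Rightarrow> nat \<Rightarrow> nat \<Rightarrow> complex) \<Rightarrow> bool" where
  "scheme_solution hbar \<rho> B Vt t x y K E F \<Psi>h \<Psi>b \<Psi>t \<Psi> \<longleftrightarrow>
     mesh_eq K (\<Psi> 0) \<Psi>h \<and>
     (\<forall>m\<ge>1.
        zero_on_boundary K (\<Psi>b m) \<and> zero_on_boundary K (\<Psi>t m) \<and> zero_on_boundary K (\<Psi> m) \<and>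
        (\<forall>j\<ge>1. \<forall>k\<in>{1..<K}.
           \<Psi>b m j k = E m j k * \<Psi> (m - 1) j k \<and>
           \<i> * of_real hbar * of_real (cell_avg x y \<rho> j k)
               * ((\<Psi>t m j k - \<Psi>b m j k) / of_real (step t m)) =
             mesh_hamiltonian hbar x y B (\<lambda>i l. (\<Psi>t m i l + \<Psi>b m i l) / 2) j k
             + of_real (aux_pot x Vt j) * ((\<Psi>t m j k + \<Psi>b m j k) / 2)
             + F m j k \<and>
           \<Psi> m j k = E m j k * \<Psi>t m j k))"

end

theory Submission imports Defs begin

text \<open>
  The potential half-steps multiply by numbers of modulus one, so they change neither the norm
  nor membership in the space: everything reduces to the middle stage, a Crank-Nicolson step for
  a symmetric operator with the weight \<rho>.

  Put w = (v + u) / 2, where u and v are the values before and after this stage. With the node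
  weight \<mu> = h_{j+1/2} \<delta>_{k+1/2}, multiplying the equation by \<mu> gives
  i d (v - u) = A w + \<mu> F, where d = (hbar / \<tau>) \<mu> \<rho> and A is the weighted Hamiltonian plus the
  weighted potential, regarded as an operator on the unweighted l2 space of the interior nodes.
  The mesh is uniform and the coefficients are constant from some column on, so the
  coefficients of A and d take finitely many values: A is bounded, and d lies between two positive constants.

  A is symmetric because it is assembled from cells like a finite element matrix: the real cell
  form has one value for every pair of corners of a cell, and it is symmetric since B is
  (mesh_hamiltonian_assembled, assemble_symmetric). The discrete summation by parts is then a mere
  shift of summation indices, without boundary terms since functions vanish outside the interior.

  Existence and uniqueness: in terms of w the step reads (2 d + i A) w = G, and
  Re ((2 d + i A) w, w) = 2 (d w, w) is coercive. A coercive bounded operator T is inverted by the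
  contraction w - \<theta> (T w - G) with small \<theta> (coercive_solvable). Since each value of T w involves
  only finitely many values of w, it is enough that the iterates converge pointwise and are bounded
  in norm.

  Stability: the imaginary part of the equation tested with v + u is the energy identity
  (d v, v) - (d u, u) = Im (\<mu> F, v + u) (cn_step_energy). The Cauchy-Schwarz inequality and division
  by the sum of the norms of u and v bound the growth in one step by \<tau> / hbar times the norm of
  F / sqrt \<rho>; for F = 0 the norm is conserved. Summation over the steps gives the theorem, even with
  the factor 1 / hbar in place of 2 / hbar.
\<close>

section \<open>Square-summable families\<close>

text \<open>
  Elements of l2 I are functions on the whole index type that vanish off I, so that all sums run
  over the same set. The weight of the mesh is not part of the norm; it is absorbed into the
  operators.
\<close>

definition l2 :: "'i set \<Rightarrow> ('i \<Rightarrow> complex) set" where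
  "l2 I = {W. (\<forall>p. p \<notin> I \<longrightarrow> W p = 0) \<and> (\<lambda>p. (cmod (W p))\<^sup>2) summable_on UNIV}"

definition nsq :: "('i \<Rightarrow> complex) \<Rightarrow> real" where
  "nsq W = (\<Sum>\<^sub>\<infinity>p. (cmod (W p))\<^sup>2)"

definition ip :: "('i \<Rightarrow> complex) \<Rightarrow> ('i \<Rightarrow> complex) \<Rightarrow> complex" where
  "ip U W = (\<Sum>\<^sub>\<infinity>p. U p * cnj (W p))"

lemma l2_summable: "W \<in> l2 I \<Longrightarrow> (\<lambda>p. (cmod (W p))\<^sup>2) summable_on UNIV"
  by (simp add: l2_def)

lemma l2_supp: "W \<in> l2 I \<Longrightarrow> p \<notin> I \<Longrightarrow> W p = 0"
  by (simp add: l2_def)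

lemma l2_mono: "W \<in> l2 I \<Longrightarrow> I \<subseteq> I' \<Longrightarrow> W \<in> l2 I'"
  by (auto simp: l2_def)

lemma l2_dominated:
  assumes "g summable_on UNIV" "\<And>p. (cmod (W p))\<^sup>2 \<le> g p" "\<And>p. p \<notin> I \<Longrightarrow> W p = 0"
  shows "W \<in> l2 I"
  unfolding l2_def using assms summable_on_comparison_test[of g UNIV "\<lambda>p. (cmod (W p))\<^sup>2"] by auto

lemma nsq_nonneg: "0 \<le> nsq W"
  unfolding nsq_def by (rule infsum_nonneg) auto

lemma finite_sum_le_nsq:
  assumes "W \<in> l2 I" "finite A"
  shows "(\<Sum>p\<in>A. (cmod (W p))\<^sup>2) \<le> nsq W"
  unfolding nsq_def by (rule finite_sum_le_infsum) (use assms l2_summable in auto)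

lemma value_le_nsq:
  assumes "W \<in> l2 I"
  shows "cmod (W p) \<le> sqrt (nsq W)"
  using finite_sum_le_nsq[OF assms, of "{p}"] by (simp add: real_le_rsqrt)

lemma l2_mult:
  assumes "W \<in> l2 I" "\<And>p. cmod (c p) \<le> M"
  shows "(\<lambda>p. c p * W p) \<in> l2 I" "nsq (\<lambda>p. c p * W p) \<le> M\<^sup>2 * nsq W"
proof -
  have le: "(cmod (c p * W p))\<^sup>2 \<le> M\<^sup>2 * (cmod (W p))\<^sup>2" for p
    using assms(2)[of p] by (simp add: norm_mult power_mult_distrib mult_right_mono power_mono)
  have s: "(\<lambda>p. M\<^sup>2 * (cmod (W p))\<^sup>2) summable_on UNIV"
    by (intro summable_on_cmult_right l2_summable[OF assms(1)])
  show mem: "(\<lambda>p. c p * W p) \<in> l2 I"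
    by (rule l2_dominated[OF s le]) (simp add: l2_supp[OF assms(1)])
  show "nsq (\<lambda>p. c p * W p) \<le> M\<^sup>2 * nsq W"
    unfolding nsq_def infsum_cmult_right'[symmetric]
    by (rule infsum_mono[OF l2_summable[OF mem] s]) (use le in auto)
qed

lemma cmod_add_sq: "(cmod (a + b))\<^sup>2 \<le> 2 * (cmod a)\<^sup>2 + 2 * (cmod b)\<^sup>2"
proof -
  have "(cmod (a + b))\<^sup>2 \<le> (cmod a + cmod b)\<^sup>2"
    by (intro power_mono norm_triangle_ineq) auto
  also have "\<dots> \<le> 2 * (cmod a)\<^sup>2 + 2 * (cmod b)\<^sup>2"
    using sum_squares_bound[of "cmod a" "cmod b"] by (simp add: power2_sum)
  finally show ?thesis .
qed

lemma l2_add: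
  assumes "U \<in> l2 I" "W \<in> l2 I"
  shows "(\<lambda>p. U p + W p) \<in> l2 I" "nsq (\<lambda>p. U p + W p) \<le> 2 * nsq U + 2 * nsq W"
proof -
  have s: "(\<lambda>p. 2 * (cmod (U p))\<^sup>2) summable_on UNIV" "(\<lambda>p. 2 * (cmod (W p))\<^sup>2) summable_on UNIV"
    by (intro summable_on_cmult_right l2_summable[OF assms(1)] l2_summable[OF assms(2)])+
  show mem: "(\<lambda>p. U p + W p) \<in> l2 I"
    by (rule l2_dominated[OF summable_on_add[OF s] cmod_add_sq])
      (simp add: l2_supp[OF assms(1)] l2_supp[OF assms(2)])
  have "nsq (\<lambda>p. U p + W p) \<le> (\<Sum>\<^sub>\<infinity>p. 2 * (cmod (U p))\<^sup>2 + 2 * (cmod (W p))\<^sup>2)"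
    unfolding nsq_def
    by (rule infsum_mono[OF l2_summable[OF mem] summable_on_add[OF s]]) (rule cmod_add_sq)
  also have "\<dots> = 2 * nsq U + 2 * nsq W"
    unfolding nsq_def by (simp add: infsum_add[OF s] infsum_cmult_right')
  finally show "nsq (\<lambda>p. U p + W p) \<le> 2 * nsq U + 2 * nsq W" .
qed

lemma l2_cmult: "W \<in> l2 I \<Longrightarrow> (\<lambda>p. c * W p) \<in> l2 I"
  by (rule l2_mult(1)[where M = "cmod c"]) auto

lemma l2_diff:
  assumes "U \<in> l2 I" "W \<in> l2 I"
  shows "(\<lambda>p. U p - W p) \<in> l2 I"
  using l2_add(1)[OF assms(1) l2_cmult[OF assms(2), of "-1"]] by simp

lemma l2_zero: "(\<lambda>p. 0) \<in> l2 I" 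
  by (simp add: l2_def)

lemma ip_summable:
  assumes "U \<in> l2 I" "W \<in> l2 I'"
  shows "(\<lambda>p. cmod (U p) * cmod (W p)) summable_on UNIV"
    "(\<lambda>p. U p * cnj (W p)) summable_on UNIV"
proof -
  have "cmod (U p) * cmod (W p) \<le> (cmod (U p))\<^sup>2 + (cmod (W p))\<^sup>2" for p
    using sum_squares_bound[of "cmod (U p)" "cmod (W p)"]
      mult_nonneg_nonneg[OF norm_ge_zero[of "U p"] norm_ge_zero[of "W p"]] by linarith
  then show *: "(\<lambda>p. cmod (U p) * cmod (W p)) summable_on UNIV"
    by (intro summable_on_comparison_test[OF summable_on_add[OF l2_summable[OF assms(1)]
          l2_summable[OF assms(2)]]]) auto
  then show "(\<lambda>p. U p * cnj (W p)) summable_on UNIV"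
    by - (rule abs_summable_summable, simp add: norm_mult)
qed

lemma sum_le_nsq_product:
  assumes "U \<in> l2 I" "W \<in> l2 I'"
  shows "(\<Sum>\<^sub>\<infinity>p. cmod (U p) * cmod (W p)) \<le> sqrt (nsq U) * sqrt (nsq W)"
proof (rule infsum_le_finite_sums[OF ip_summable(1)[OF assms]])
  fix A :: "'a set" assume A: "finite A"
  have "(\<Sum>p\<in>A. cmod (U p) * cmod (W p))
      \<le> L2_set (\<lambda>p. cmod (U p)) A * L2_set (\<lambda>p. cmod (W p)) A"
    using L2_set_mult_ineq[of "\<lambda>p. cmod (U p)" "\<lambda>p. cmod (W p)" A] by simp
  also have "\<dots> \<le> sqrt (nsq U) * sqrt (nsq W)"
    unfolding L2_set_def using finite_sum_le_nsq[OF assms(1) A] finite_sum_le_nsq[OF assms(2) A]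
    by (intro mult_mono real_sqrt_le_mono) (auto intro: sum_nonneg nsq_nonneg)
  finally show "(\<Sum>p\<in>A. cmod (U p) * cmod (W p)) \<le> sqrt (nsq U) * sqrt (nsq W)" .
qed

lemma sqrt_nsq_triangle:
  assumes "U \<in> l2 I" "W \<in> l2 I"
  shows "sqrt (nsq (\<lambda>p. U p + W p)) \<le> sqrt (nsq U) + sqrt (nsq W)"
proof (rule real_le_lsqrt)
  show "0 \<le> sqrt (nsq U) + sqrt (nsq W)" by (simp add: nsq_nonneg)
  show "nsq (\<lambda>p. U p + W p) \<le> (sqrt (nsq U) + sqrt (nsq W))\<^sup>2"
    unfolding nsq_def[of "\<lambda>p. U p + W p"]
  proof (rule infsum_le_finite_sums[OF l2_summable[OF l2_add(1)[OF assms]]])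
    fix A :: "'a set" assume A: "finite A"
    have "(\<Sum>p\<in>A. (cmod (U p + W p))\<^sup>2) \<le> (\<Sum>p\<in>A. (cmod (U p) + cmod (W p))\<^sup>2)"
      by (intro sum_mono power_mono norm_triangle_ineq) auto
    also have "\<dots> = (L2_set (\<lambda>p. cmod (U p) + cmod (W p)) A)\<^sup>2"
      by (simp add: L2_set_def sum_nonneg)
    also have "\<dots> \<le> (L2_set (\<lambda>p. cmod (U p)) A + L2_set (\<lambda>p. cmod (W p)) A)\<^sup>2"
      by (intro power_mono L2_set_triangle_ineq) auto
    also have "\<dots> \<le> (sqrt (nsq U) + sqrt (nsq W))\<^sup>2"
      unfolding L2_set_def using finite_sum_le_nsq[OF assms(1) A] finite_sum_le_nsq[OF assms(2) A]
      by (intro power_mono add_mono real_sqrt_le_mono) (auto intro!: sum_nonneg add_nonneg_nonneg)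
    finally show "(\<Sum>p\<in>A. (cmod (U p + W p))\<^sup>2) \<le> (sqrt (nsq U) + sqrt (nsq W))\<^sup>2" .
  qed
qed

lemma nsq_eq_0_imp: 
  assumes "W \<in> l2 I" "nsq W \<le> 0"
  shows "W p = 0"
  using value_le_nsq[OF assms(1), of p] assms(2) nsq_nonneg[of W] by simp

section \<open>Coercive operators that commute with pointwise limits\<close>

text \<open>
  Expanding the square gives nsq u - 2 \<theta> Re (l, u) + \<theta>^2 nsq l. With l = T u the middle term
  wins for small \<theta>, because it is linear in \<theta>.
\<close>

lemma relaxed_step_contracts:
  assumes u: "u \<in> l2 I" and l: "l \<in> l2 I" and bdd: "nsq l \<le> C * nsq u"
    and coer: "c * nsq u \<le> Re (ip l u)" and \<theta>: "\<theta> \<ge> 0"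
  shows "nsq (\<lambda>p. u p - of_real \<theta> * l p) \<le> (1 - 2 * \<theta> * c + \<theta>\<^sup>2 * C) * nsq u"
proof -
  have s1: "(\<lambda>p. (cmod (u p))\<^sup>2) summable_on UNIV" by (rule l2_summable[OF u])
  have s2: "(\<lambda>p. - 2 * \<theta> * Re (l p * cnj (u p))) summable_on UNIV"
    by (intro summable_on_cmult_right summable_on_Re ip_summable(2)[OF l u])
  have s3: "(\<lambda>p. \<theta>\<^sup>2 * (cmod (l p))\<^sup>2) summable_on UNIV"
    by (intro summable_on_cmult_right l2_summable[OF l])
  have pt: "(cmod (u p - of_real \<theta> * l p))\<^sup>2
      = (cmod (u p))\<^sup>2 + - 2 * \<theta> * Re (l p * cnj (u p)) + \<theta>\<^sup>2 * (cmod (l p))\<^sup>2" for p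
    unfolding cmod_power2 by (simp add: power2_eq_square algebra_simps)
  have "nsq (\<lambda>p. u p - of_real \<theta> * l p) = nsq u + - 2 * \<theta> * Re (ip l u) + \<theta>\<^sup>2 * nsq l"
    unfolding nsq_def ip_def pt infsum_Re[OF ip_summable(2)[OF l u], symmetric]
    by (simp only: infsum_add[OF summable_on_add[OF s1 s2] s3] infsum_add[OF s1 s2]
        infsum_cmult_right')
  also have "\<dots> \<le> nsq u - 2 * \<theta> * (c * nsq u) + \<theta>\<^sup>2 * (C * nsq u)"
    using mult_left_mono[OF coer, of "2 * \<theta>"] mult_left_mono[OF bdd, of "\<theta>\<^sup>2"] \<theta> by simp
  finally show ?thesis by (simp add: algebra_simps)
qed

text \<open>
  This replaces completeness: finite partial sums pass to the limit, and they are bounded by the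
  common bound of the norms.
\<close>

lemma l2_pointwise_limit:
  assumes w: "\<And>n. w n \<in> l2 I" and R: "\<And>n. sqrt (nsq (w n)) \<le> R"
    and lim: "\<And>p. (\<lambda>n. w n p) \<longlonglongrightarrow> W p"
  shows "W \<in> l2 I"
proof -
  have fin: "(\<Sum>p\<in>A. (cmod (W p))\<^sup>2) \<le> R\<^sup>2" if "finite A" for A
  proof (rule LIMSEQ_le_const2)
    show "(\<lambda>n. \<Sum>p\<in>A. (cmod (w n p))\<^sup>2) \<longlonglongrightarrow> (\<Sum>p\<in>A. (cmod (W p))\<^sup>2)"
      by (intro tendsto_intros lim)
    have "(\<Sum>p\<in>A. (cmod (w n p))\<^sup>2) \<le> R\<^sup>2" for n
      using finite_sum_le_nsq[OF w that, of n] sqrt_le_D[OF R[of n]] by linarith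
    then show "\<exists>N. \<forall>n\<ge>N. (\<Sum>p\<in>A. (cmod (w n p))\<^sup>2) \<le> R\<^sup>2" by blast
  qed
  have "W p = 0" if "p \<notin> I" for p
    using lim[of p] l2_supp[OF w that] by (simp add: LIMSEQ_const_iff)
  moreover have "(\<lambda>p. (cmod (W p))\<^sup>2) summable_on UNIV"
    by (rule nonneg_bdd_above_summable_on) (auto intro!: bdd_aboveI[of _ "R\<^sup>2"] fin)
  ultimately show ?thesis by (simp add: l2_def)
qed

text \<open>
  A form of the Lax-Milgram lemma. Relaxation w - \<theta> (T w - G) contracts in norm, so its iterates
  converge pointwise at a geometric rate and stay bounded in norm; continuity of T with respect to
  pointwise convergence identifies the limit as a solution.
\<close>

theorem coercive_solvable:
  fixes T :: "('i \<Rightarrow> complex) \<Rightarrow> 'i \<Rightarrow> complex"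
  assumes diff: "\<And>u v p. T (\<lambda>q. u q - v q) p = T u p - T v p"
    and cont: "\<And>w W p. (\<And>q. (\<lambda>n. w n q) \<longlonglongrightarrow> W q) \<Longrightarrow> (\<lambda>n. T (w n) p) \<longlonglongrightarrow> T W p"
    and bdd: "\<And>W. W \<in> l2 I \<Longrightarrow> T W \<in> l2 I \<and> nsq (T W) \<le> C * nsq W"
    and coer: "\<And>W. W \<in> l2 I \<Longrightarrow> c * nsq W \<le> Re (ip (T W) W)" and c: "c > 0"
    and G: "G \<in> l2 I"
  shows "\<exists>W\<in>l2 I. \<forall>p. T W p = G p"
proof -
  \<comment> \<open>The summand c^2 keeps the contraction factor q nonnegative. The choice of \<theta> minimises 1 - 2 \<theta> c + \<theta>^2 C over \<theta>, with C replaced by its upper bound.\<close>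
  define C' where "C' = \<bar>C\<bar> + c\<^sup>2"
  define \<theta> where "\<theta> = c / C'"
  define q where "q = 1 - c\<^sup>2 / C'"
  have C': "C' > 0" "C \<le> C'" "c\<^sup>2 \<le> C'" using c by (auto simp: C'_def add_nonneg_pos intro: add_increasing2)
  have \<theta>: "\<theta> > 0" using C' c by (simp add: \<theta>_def)
  have q: "0 \<le> q" "q < 1" using C' c by (auto simp: q_def)
  have contr: "nsq (\<lambda>p. u p - of_real \<theta> * T u p) \<le> q * nsq u" if u: "u \<in> l2 I" for u
  proof -
    have "nsq (T u) \<le> C' * nsq u"
      using bdd[OF u] mult_right_mono[OF C'(2) nsq_nonneg[of u]] by linarith
    then have "nsq (\<lambda>p. u p - of_real \<theta> * T u p) \<le> (1 - 2 * \<theta> * c + \<theta>\<^sup>2 * C') * nsq u"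
      using relaxed_step_contracts[OF u _ _ coer[OF u], where C = C' and \<theta> = \<theta>] bdd[OF u] \<theta> by simp
    also have "1 - 2 * \<theta> * c + \<theta>\<^sup>2 * C' = q"
      using C' by (simp add: \<theta>_def q_def field_simps power2_eq_square)
    finally show ?thesis .
  qed
  define w where "w = rec_nat (\<lambda>p. 0) (\<lambda>_ u p. u p - of_real \<theta> * (T u p - G p))"
  have w0: "w 0 = (\<lambda>p. 0)" and wS: "w (Suc n) = (\<lambda>p. w n p - of_real \<theta> * (T (w n) p - G p))" for n
    by (simp_all add: w_def)
  have w: "w n \<in> l2 I" for n
  proof (induction n)
    case (Suc n)
    then show ?case unfolding wS using bdd[of "w n"]
      by (intro l2_diff l2_cmult G) auto
  qed (simp add: w0 l2_zero)
  define D where "D n = (\<lambda>p. w (Suc n) p - w n p)" for n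
  have D: "D n \<in> l2 I" for n unfolding D_def by (intro l2_diff w)
  have DS: "D (Suc n) = (\<lambda>p. D n p - of_real \<theta> * T (D n) p)" for n
  proof
    fix p
    have "T (D n) p = T (w (Suc n)) p - T (w n) p" unfolding D_def by (rule diff)
    moreover have "D (Suc n) p = (w (Suc n) p - w n p) - of_real \<theta> * (T (w (Suc n)) p - T (w n) p)"
      unfolding D_def wS[of "Suc n"] wS[of n] by (simp add: algebra_simps)
    ultimately show "D (Suc n) p = D n p - of_real \<theta> * T (D n) p" by (simp add: D_def)
  qed
  have nD: "nsq (D n) \<le> q ^ n * nsq (D 0)" for n
  proof (induction n)
    case (Suc n)
    have "nsq (D (Suc n)) \<le> q * nsq (D n)" unfolding DS by (rule contr[OF D])
    also have "\<dots> \<le> q * (q ^ n * nsq (D 0))" using Suc q by (intro mult_left_mono)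
    finally show ?case by (simp add: mult.assoc)
  qed simp
  define r where "r = sqrt q"
  define d where "d = sqrt (nsq (D 0))"
  have r: "0 \<le> r" "r < 1" using q by (auto simp: r_def)
  have d: "d \<ge> 0" by (simp add: d_def nsq_nonneg)
  \<comment> \<open>The increments of the iteration decay like powers of r, both in norm and at each index.\<close>
  have sD: "sqrt (nsq (D n)) \<le> d * r ^ n" for n
    using real_sqrt_le_mono[OF nD[of n]] by (simp add: real_sqrt_mult real_sqrt_power r_def d_def mult.commute)
  have geo: "summable (\<lambda>n. d * r ^ n)" using r by (intro summable_mult summable_geometric) simp
  have sumD: "summable (\<lambda>n. D n p)" for p
  proof (rule summable_comparison_test'[OF geo, of 0])
    show "cmod (D n p) \<le> d * r ^ n" for n
      using value_le_nsq[OF D, of n p] sD[of n] by linarith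
  qed
  have "(\<Sum>i<n. D i p) = w n p" for n p
    using sum_lessThan_telescope[of "\<lambda>i. w i p" n] by (simp add: D_def w0)
  then have "convergent (\<lambda>n. w n p)" for p
    using sumD[of p] unfolding summable_iff_convergent by simp
  then obtain W where W: "\<And>p. (\<lambda>n. w n p) \<longlonglongrightarrow> W p"
    unfolding convergent_def by metis
  have "sqrt (nsq (w n)) \<le> (\<Sum>i<n. d * r ^ i)" for n
  proof (induction n)
    case (Suc n)
    have "w (Suc n) = (\<lambda>p. w n p + D n p)" by (simp add: D_def)
    then have "sqrt (nsq (w (Suc n))) \<le> sqrt (nsq (w n)) + sqrt (nsq (D n))"
      using sqrt_nsq_triangle[OF w[of n] D[of n]] by simp
    then show ?case using Suc sD[of n] by simp
  qed (simp add: w0 nsq_def)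
  moreover have "(\<Sum>i<n. d * r ^ i) \<le> suminf (\<lambda>i. d * r ^ i)" for n
    using r d by (intro sum_le_suminf geo) auto
  ultimately have WI: "W \<in> l2 I"
    by (intro l2_pointwise_limit[OF w _ W, of "suminf (\<lambda>i. d * r ^ i)"]) (rule order_trans)
  have "T W p = G p" for p
  proof -
    have "(\<lambda>n. w (Suc n) p) \<longlonglongrightarrow> W p - of_real \<theta> * (T W p - G p)"
      unfolding wS by (intro tendsto_intros W cont)
    moreover have "(\<lambda>n. w (Suc n) p) \<longlonglongrightarrow> W p" using W by (rule LIMSEQ_Suc)
    ultimately have "W p - of_real \<theta> * (T W p - G p) = W p" by (rule LIMSEQ_unique)
    then show ?thesis using \<theta> by simp
  qed
  then show ?thesis using WI by blast
qed

section \<open>Crank-Nicolson steps of a symmetric operator\<close>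

text \<open>
  Boundedness without a named constant, so that it can be derived from the way an operator is
  composed of shifts and multiplications.
\<close>

definition l2_bounded :: "(('i \<Rightarrow> complex) \<Rightarrow> 'i \<Rightarrow> complex) \<Rightarrow> bool" where
  "l2_bounded T \<longleftrightarrow> (\<exists>C. \<forall>W\<in>l2 UNIV. T W \<in> l2 UNIV \<and> nsq (T W) \<le> C * nsq W)"

lemma l2_boundedI:
  assumes "\<And>W. W \<in> l2 UNIV \<Longrightarrow> T W \<in> l2 UNIV" "\<And>W. W \<in> l2 UNIV \<Longrightarrow> nsq (T W) \<le> C * nsq W"
  shows "l2_bounded T"
  using assms unfolding l2_bounded_def by blast

lemma l2_boundedE:
  assumes "l2_bounded T"
  obtains C where "C \<ge> 0" "\<And>W. W \<in> l2 UNIV \<Longrightarrow> T W \<in> l2 UNIV"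
    "\<And>W. W \<in> l2 UNIV \<Longrightarrow> nsq (T W) \<le> C * nsq W"
proof -
  obtain C where C: "\<forall>W\<in>l2 UNIV. T W \<in> l2 UNIV \<and> nsq (T W) \<le> C * nsq W"
    using assms unfolding l2_bounded_def by blast
  have "nsq (T W) \<le> \<bar>C\<bar> * nsq W" if "W \<in> l2 UNIV" for W
    using C that mult_right_mono[OF abs_ge_self[of C] nsq_nonneg[of W]] by fastforce
  then show thesis using that[of "\<bar>C\<bar>"] C by simp
qed

lemma l2_boundedD: "l2_bounded T \<Longrightarrow> W \<in> l2 UNIV \<Longrightarrow> T W \<in> l2 UNIV"
  unfolding l2_bounded_def by blast

lemma l2_bounded_zero: "l2_bounded (\<lambda>W p. 0)"
  by (rule l2_boundedI[where C = 0]) (auto simp: l2_zero nsq_def)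

lemma l2_bounded_add:
  assumes "l2_bounded S" "l2_bounded T"
  shows "l2_bounded (\<lambda>W p. S W p + T W p)"
proof -
  obtain C where C: "\<And>W. W \<in> l2 UNIV \<Longrightarrow> S W \<in> l2 UNIV" "\<And>W. W \<in> l2 UNIV \<Longrightarrow> nsq (S W) \<le> C * nsq W"
    using l2_boundedE[OF assms(1)] by metis
  obtain C' where C': "\<And>W. W \<in> l2 UNIV \<Longrightarrow> T W \<in> l2 UNIV" "\<And>W. W \<in> l2 UNIV \<Longrightarrow> nsq (T W) \<le> C' * nsq W"
    using l2_boundedE[OF assms(2)] by metis
  show ?thesis
  proof (rule l2_boundedI[where C = "2 * C + 2 * C'"])
    fix W :: "'a \<Rightarrow> complex" assume W: "W \<in> l2 UNIV"
    show "(\<lambda>p. S W p + T W p) \<in> l2 UNIV" by (rule l2_add(1)[OF C(1)[OF W] C'(1)[OF W]])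
    show "nsq (\<lambda>p. S W p + T W p) \<le> (2 * C + 2 * C') * nsq W"
      using l2_add(2)[OF C(1)[OF W] C'(1)[OF W]] C(2)[OF W] C'(2)[OF W] by (simp add: algebra_simps)
  qed
qed

lemma l2_bounded_sum:
  assumes "finite A" "\<And>a. a \<in> A \<Longrightarrow> l2_bounded (T a)"
  shows "l2_bounded (\<lambda>W p. \<Sum>a\<in>A. T a W p)"
  using assms by (induction A rule: finite_induct) (auto simp: l2_bounded_zero intro!: l2_bounded_add)

lemma l2_bounded_mult:
  assumes "l2_bounded T" "\<And>p. cmod (c p) \<le> M"
  shows "l2_bounded (\<lambda>W p. c p * T W p)"
proof -
  obtain C where C: "\<And>W. W \<in> l2 UNIV \<Longrightarrow> T W \<in> l2 UNIV" "\<And>W. W \<in> l2 UNIV \<Longrightarrow> nsq (T W) \<le> C * nsq W"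
    using l2_boundedE[OF assms(1)] by metis
  show ?thesis
  proof (rule l2_boundedI[where C = "M\<^sup>2 * C"])
    fix W :: "'a \<Rightarrow> complex" assume W: "W \<in> l2 UNIV"
    show "(\<lambda>p. c p * T W p) \<in> l2 UNIV" by (rule l2_mult(1)[OF C(1)[OF W] assms(2)])
    show "nsq (\<lambda>p. c p * T W p) \<le> M\<^sup>2 * C * nsq W"
      using l2_mult(2)[where W = "T W" and c = c, OF C(1)[OF W] assms(2)]
        mult_left_mono[OF C(2)[OF W], of "M\<^sup>2"]
      by (simp add: mult.assoc)
  qed
qed

lemma l2_bounded_comp:
  assumes "l2_bounded S" "l2_bounded T"
  shows "l2_bounded (\<lambda>W. S (T W))"
proof -
  obtain C where C: "C \<ge> 0" "\<And>W. W \<in> l2 UNIV \<Longrightarrow> S W \<in> l2 UNIV" "\<And>W. W \<in> l2 UNIV \<Longrightarrow> nsq (S W) \<le> C * nsq W"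
    using l2_boundedE[OF assms(1)] by metis
  obtain C' where C': "\<And>W. W \<in> l2 UNIV \<Longrightarrow> T W \<in> l2 UNIV" "\<And>W. W \<in> l2 UNIV \<Longrightarrow> nsq (T W) \<le> C' * nsq W"
    using l2_boundedE[OF assms(2)] by metis
  show ?thesis
  proof (rule l2_boundedI[where C = "C * C'"])
    fix W :: "'a \<Rightarrow> complex" assume W: "W \<in> l2 UNIV"
    show "S (T W) \<in> l2 UNIV" by (rule C(2)[OF C'(1)[OF W]])
    show "nsq (S (T W)) \<le> C * C' * nsq W"
      using C(3)[OF C'(1)[OF W]] mult_left_mono[OF C'(2)[OF W] C(1)] by simp
  qed
qed

text \<open>
  The properties of an operator with finite stencil that a Crank-Nicolson step relies on. Symmetry
  is stated as reality of the quadratic form, and only on functions that vanish off I.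
\<close>

locale symmetric_operator =
  fixes I :: "'i set" and A :: "('i \<Rightarrow> complex) \<Rightarrow> 'i \<Rightarrow> complex"
  assumes diff: "A (\<lambda>q. u q - v q) p = A u p - A v p"
    and cont: "(\<And>q. (\<lambda>n. w n q) \<longlonglongrightarrow> W q) \<Longrightarrow> (\<lambda>n. A (w n) p) \<longlonglongrightarrow> A W p"
    and supp: "p \<notin> I \<Longrightarrow> A W p = 0"
    and bounded: "l2_bounded A"
    and sym: "W \<in> l2 I \<Longrightarrow> Im (ip (A W) W) = 0"
begin

lemma A_l2: "W \<in> l2 I \<Longrightarrow> A W \<in> l2 I"
  using bounded supp l2_mono[of W I UNIV] unfolding l2_bounded_def l2_def by auto

text \<open>
  The operator d + i A is coercive with the constant c: the real part of its quadratic form is the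
  form of d alone, as the form of A is real.
\<close>

lemma resolvent:
  fixes d :: "'i \<Rightarrow> real"
  assumes d: "\<And>p. p \<in> I \<Longrightarrow> c \<le> d p" "\<And>p. p \<in> I \<Longrightarrow> d p \<le> M" and c: "c > 0"
    and G: "G \<in> l2 I"
  shows "\<exists>W\<in>l2 I. \<forall>p\<in>I. of_real (d p) * W p + \<i> * A W p = G p"
proof -
  define d' where "d' p = (if p \<in> I then complex_of_real (d p) else 0)" for p
  define T where "T = (\<lambda>W p. d' p * W p + \<i> * A W p)"
  have d'M: "cmod (d' p) \<le> \<bar>M\<bar>" for p using d[of p] c by (auto simp: d'_def)
  have "l2_bounded (\<lambda>W p. W p)" by (rule l2_boundedI[where C = 1]) auto
  then have "l2_bounded T" unfolding T_def
    by (intro l2_bounded_add l2_bounded_mult[OF _ d'M] l2_bounded_mult[OF bounded, where M = 1]) auto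
  then obtain C where C: "\<And>W. W \<in> l2 UNIV \<Longrightarrow> T W \<in> l2 UNIV" "\<And>W. W \<in> l2 UNIV \<Longrightarrow> nsq (T W) \<le> C * nsq W"
    using l2_boundedE by metis
  have supT: "T W p = 0" if "p \<notin> I" for W p using that by (simp add: T_def d'_def supp)
  have "\<exists>W\<in>l2 I. \<forall>p. T W p = G p"
  proof (rule coercive_solvable[OF _ _ _ _ c G, of T C])
    show "T (\<lambda>q. u q - v q) p = T u p - T v p" for u v p
      unfolding T_def diff by (simp add: algebra_simps)
    show "(\<lambda>n. T (w n) p) \<longlonglongrightarrow> T W p" if "\<And>q. (\<lambda>n. w n q) \<longlonglongrightarrow> W q" for w W p
      unfolding T_def by (intro tendsto_intros cont that)
    fix W assume W: "W \<in> l2 I"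
    have W': "W \<in> l2 UNIV" by (rule l2_mono[OF W]) auto
    show "T W \<in> l2 I \<and> nsq (T W) \<le> C * nsq W"
      using C[OF W'] supT by (auto simp: l2_def)
    have s: "(\<lambda>p. d' p * W p * cnj (W p)) summable_on UNIV" "(\<lambda>p. A W p * cnj (W p)) summable_on UNIV"
      by (intro ip_summable(2)[OF l2_mult(1)[OF W d'M] W] ip_summable(2)[OF A_l2[OF W] W])+
    have "ip (T W) W = (\<Sum>\<^sub>\<infinity>p. d' p * W p * cnj (W p)) + \<i> * ip (A W) W"
      unfolding ip_def T_def distrib_right mult.assoc[of \<i>]
      by (simp only: infsum_add[OF s(1) summable_on_cmult_right[OF s(2)]] infsum_cmult_right')
    then have "Re (ip (T W) W) = (\<Sum>\<^sub>\<infinity>p. Re (d' p * W p * cnj (W p)))"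
      unfolding infsum_Re[OF s(1)] by (simp add: sym[OF W])
    also have "c * nsq W \<le> \<dots>"
      unfolding nsq_def infsum_cmult_right'[symmetric]
    proof (rule infsum_mono[OF summable_on_cmult_right[OF l2_summable[OF W]] summable_on_Re[OF s(1)]])
      fix p
      show "c * (cmod (W p))\<^sup>2 \<le> Re (d' p * W p * cnj (W p))"
        using d(1)[of p] l2_supp[OF W, of p] 
        by (cases "p \<in> I")
          (auto simp: d'_def mult.assoc complex_mult_cnj cmod_power2[symmetric] mult_right_mono
            simp del: of_real_power of_real_add)
    qed
    finally show "c * nsq W \<le> Re (ip (T W) W)" .
  qed
  then obtain W where W: "W \<in> l2 I" "\<And>p. T W p = G p" by blast
  have "of_real (d p) * W p + \<i> * A W p = G p" if "p \<in> I" for p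
    using W(2)[of p] that by (simp add: T_def d'_def)
  then show ?thesis using W(1) by blast
qed

text \<open>
  The Crank-Nicolson step from u to v. The time step and the weight are contained in d.
\<close>

definition cn_step :: "('i \<Rightarrow> real) \<Rightarrow> ('i \<Rightarrow> complex) \<Rightarrow> ('i \<Rightarrow> complex) \<Rightarrow> ('i \<Rightarrow> complex) \<Rightarrow> bool" where
  "cn_step d f u v \<longleftrightarrow>
     (\<forall>p\<in>I. \<i> * of_real (d p) * (v p - u p) = A (\<lambda>q. (v q + u q) / 2) p + f p)"

text \<open>
  In terms of the mean w of u and v the step is a resolvent equation, as v - u = 2 (w - u).
\<close>

lemma cn_step_exists:
  assumes d: "\<And>p. p \<in> I \<Longrightarrow> c \<le> d p" "\<And>p. p \<in> I \<Longrightarrow> d p \<le> M" and c: "c > 0"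
    and f: "f \<in> l2 I" and u: "u \<in> l2 I"
  shows "\<exists>v\<in>l2 I. cn_step d f u v"
proof -
  define d' where "d' p = (if p \<in> I then complex_of_real (2 * d p) else 0)" for p
  have "cmod (d' p) \<le> 2 * \<bar>M\<bar>" for p using d[of p] c by (auto simp: d'_def)
  then have "(\<lambda>p. d' p * u p - \<i> * f p) \<in> l2 I"
    by (intro l2_diff l2_cmult l2_mult(1)[OF u] f)
  then obtain w where w: "w \<in> l2 I"
    and eq: "\<And>p. p \<in> I \<Longrightarrow> of_real (2 * d p) * w p + \<i> * A w p = d' p * u p - \<i> * f p"
    using resolvent[of "2 * c" "\<lambda>p. 2 * d p" "2 * M"] d c by force
  define v where "v = (\<lambda>p. 2 * w p - u p)"
  have "\<i> * of_real (d p) * (v p - u p) = A w p + f p" if p: "p \<in> I" for p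
    using arg_cong[OF eq[OF p], of "\<lambda>z. \<i> * z"] p
    by (simp add: v_def d'_def algebra_simps)
  moreover have "(\<lambda>q. (v q + u q) / 2) = w" by (simp add: v_def)
  moreover have "v \<in> l2 I" unfolding v_def by (intro l2_diff l2_cmult w u)
  ultimately show ?thesis unfolding cn_step_def by auto
qed

text \<open>
  Testing the step with v + u: the number i (v - u) cnj (v + u) has the imaginary part |v|^2 - |u|^2,
  and A contributes twice the value of its real quadratic form at the mean of u and v.
\<close>

lemma cn_step_energy:
  assumes d: "\<And>p. p \<in> I \<Longrightarrow> \<bar>d p\<bar> \<le> M"
    and f: "f \<in> l2 I" and u: "u \<in> l2 I" and v: "v \<in> l2 I" and step: "cn_step d f u v"
  shows "(\<Sum>\<^sub>\<infinity>p. d p * (cmod (v p))\<^sup>2) - (\<Sum>\<^sub>\<infinity>p. d p * (cmod (u p))\<^sup>2)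
    = Im (ip f v) + Im (ip f u)"
proof -
  define w where "w = (\<lambda>q. (v q + u q) / 2)"
  have w: "w \<in> l2 I" using l2_cmult[OF l2_add(1)[OF v u], of "1/2"] by (simp add: w_def)
  have sd: "(\<lambda>p. d p * (cmod (W p))\<^sup>2) summable_on UNIV" if W: "W \<in> l2 I" for W
  proof -
    have "norm (d p * (cmod (W p))\<^sup>2) \<le> M * (cmod (W p))\<^sup>2" for p
      using d[of p] l2_supp[OF W, of p] by (cases "p \<in> I") (auto simp: abs_mult mult_right_mono)
    then have "(\<lambda>p. norm (d p * (cmod (W p))\<^sup>2)) summable_on UNIV"
      by (intro summable_on_comparison_test[OF summable_on_cmult_right[OF l2_summable[OF W]]]) auto
    then show ?thesis by (rule abs_summable_summable)
  qed
  have s: "(\<lambda>p. A w p * cnj (w p)) summable_on UNIV" "(\<lambda>p. f p * cnj (v p)) summable_on UNIV"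
    "(\<lambda>p. f p * cnj (u p)) summable_on UNIV"
    by (intro ip_summable(2)[OF A_l2[OF w] w] ip_summable(2)[OF f v] ip_summable(2)[OF f u])+
  have pt: "d p * (cmod (v p))\<^sup>2 - d p * (cmod (u p))\<^sup>2
      = 2 * Im (A w p * cnj (w p)) + (Im (f p * cnj (v p)) + Im (f p * cnj (u p)))" for p
  proof (cases "p \<in> I")
    case True
    then have eq: "\<i> * of_real (d p) * (v p - u p) = A w p + f p"
      using step by (simp add: cn_step_def w_def)
    have "Im (\<i> * of_real (d p) * (v p - u p) * cnj (v p + u p))
        = d p * (cmod (v p))\<^sup>2 - d p * (cmod (u p))\<^sup>2"
      unfolding cmod_power2 by (simp add: algebra_simps power2_eq_square)
    moreover have "cnj (v p + u p) = 2 * cnj (w p)" by (simp add: w_def)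
    ultimately have "d p * (cmod (v p))\<^sup>2 - d p * (cmod (u p))\<^sup>2
        = Im (A w p * (2 * cnj (w p)) + f p * cnj (v p + u p))"
      unfolding eq by (metis distrib_right)
    also have "\<dots> = 2 * Im (A w p * cnj (w p)) + (Im (f p * cnj (v p)) + Im (f p * cnj (u p)))"
      by (simp add: algebra_simps)
    finally show ?thesis .
  next
    case False
    then show ?thesis using l2_supp[OF u] l2_supp[OF v] l2_supp[OF w] l2_supp[OF f] by simp
  qed
  have sv: "(\<lambda>p. - (d p * (cmod (u p))\<^sup>2)) summable_on UNIV"
    using summable_on_cmult_right[OF sd[OF u], of "-1"] by simp
  have "(\<Sum>\<^sub>\<infinity>p. d p * (cmod (v p))\<^sup>2) - (\<Sum>\<^sub>\<infinity>p. d p * (cmod (u p))\<^sup>2)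
      = (\<Sum>\<^sub>\<infinity>p. d p * (cmod (v p))\<^sup>2 + - (d p * (cmod (u p))\<^sup>2))"
    unfolding infsum_add[OF sd[OF v] sv] infsum_uminus by simp
  also have "\<dots> = 2 * Im (ip (A w) w) + (Im (ip f v) + Im (ip f u))"
    unfolding add_uminus_conv_diff pt ip_def
      infsum_Im[OF s(1), symmetric] infsum_Im[OF s(2), symmetric] infsum_Im[OF s(3), symmetric]
    by (simp only: infsum_add[OF summable_on_cmult_right[OF summable_on_Im[OF s(1)]]
          summable_on_add[OF summable_on_Im[OF s(2)] summable_on_Im[OF s(3)]]]
        infsum_add[OF summable_on_Im[OF s(2)] summable_on_Im[OF s(3)]] infsum_cmult_right')
  finally show ?thesis by (simp add: sym[OF w])
qed

text \<open>
  The difference of two solutions is a step from 0 without force, so its energy vanishes.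
\<close>

lemma cn_step_unique:
  assumes d: "\<And>p. p \<in> I \<Longrightarrow> c \<le> d p" "\<And>p. p \<in> I \<Longrightarrow> d p \<le> M" and c: "c > 0"
    and v: "v \<in> l2 I" "v' \<in> l2 I" and step: "cn_step d f u v" "cn_step d f u v'"
  shows "v p = v' p"
proof -
  define z where "z = (\<lambda>p. v p - v' p)"
  have z: "z \<in> l2 I" unfolding z_def by (rule l2_diff[OF v])
  have "cn_step d (\<lambda>p. 0) (\<lambda>p. 0) z" unfolding cn_step_def
  proof
    fix p assume p: "p \<in> I"
    have "A (\<lambda>q. (z q + 0) / 2) p = A (\<lambda>q. (v q + u q) / 2 - (v' q + u q) / 2) p"
      by (simp add: z_def diff_divide_distrib add_divide_distrib)
    also have "\<dots> = A (\<lambda>q. (v q + u q) / 2) p - A (\<lambda>q. (v' q + u q) / 2) p" by (rule diff)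
    also have "\<dots> = \<i> * of_real (d p) * (v p - u p) - \<i> * of_real (d p) * (v' p - u p)"
      using step p unfolding cn_step_def by simp
    finally show "\<i> * of_real (d p) * (z p - 0) = A (\<lambda>q. (z q + 0) / 2) p + 0"
      by (simp add: z_def algebra_simps)
  qed
  then have 0: "(\<Sum>\<^sub>\<infinity>p. d p * (cmod (z p))\<^sup>2) = 0"
    using cn_step_energy[of d M "\<lambda>p. 0" "\<lambda>p. 0" z] d c z by (fastforce simp: ip_def l2_zero)
  have s: "(\<lambda>p. d p * (cmod (z p))\<^sup>2) summable_on UNIV"
  proof (rule summable_on_comparison_test[OF summable_on_cmult_right[OF l2_summable[OF z], of M]])
    fix p
    show "d p * (cmod (z p))\<^sup>2 \<le> M * (cmod (z p))\<^sup>2" "0 \<le> d p * (cmod (z p))\<^sup>2"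
      using d[of p] c l2_supp[OF z, of p] by (cases "p \<in> I"; auto simp: mult_right_mono)+
  qed
  have "c * nsq z \<le> (\<Sum>\<^sub>\<infinity>p. d p * (cmod (z p))\<^sup>2)"
    unfolding nsq_def infsum_cmult_right'[symmetric]
  proof (rule infsum_mono[OF summable_on_cmult_right[OF l2_summable[OF z]] s])
    fix p
    show "c * (cmod (z p))\<^sup>2 \<le> d p * (cmod (z p))\<^sup>2"
      using d[of p] l2_supp[OF z, of p] by (cases "p \<in> I"; auto simp: mult_right_mono)
  qed
  then have "nsq z \<le> 0" using 0 c by (simp add: mult_le_0_iff)
  from nsq_eq_0_imp[OF z this, of p] show ?thesis by (simp add: z_def)
qed

end

section \<open>Operators assembled from cells\<close>

text \<open>
  The cell c has the node c as its lower left corner, and its corners are c + \<alpha> with \<alpha> in corners.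
\<close>

definition corners :: "(nat \<times> nat) set" where
  "corners = {0, 1} \<times> {0, 1}"

text \<open>
  Translation by \<alpha>, the adjoint of the shift W (c + \<alpha>). Nodes that are not of the form c + \<alpha> get
  the value 0; truncated subtraction would give them a wrong one.
\<close>

definition push :: "nat \<times> nat \<Rightarrow> (nat \<times> nat \<Rightarrow> complex) \<Rightarrow> nat \<times> nat \<Rightarrow> complex" where
  "push \<alpha> G p = (if fst \<alpha> \<le> fst p \<and> snd \<alpha> \<le> snd p then G (p - \<alpha>) else 0)"

text \<open>
  The row of the element matrix e c that belongs to the corner \<alpha>, applied to the corner values.
\<close>

definition cell_residual ::
  "(nat \<times> nat \<Rightarrow> nat \<times> nat \<Rightarrow> nat \<times> nat \<Rightarrow> real) \<Rightarrow> nat \<times> nat \<Rightarrow> (nat \<times> nat \<Rightarrow> complex)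
    \<Rightarrow> nat \<times> nat \<Rightarrow> complex" where
  "cell_residual e \<alpha> W c = (\<Sum>\<beta>\<in>corners. of_real (e c \<alpha> \<beta>) * W (c + \<beta>))"

text \<open>
  Assembly as for finite elements: the value at a node collects the contributions of the four cells
  that have it as a corner.
\<close>

definition assemble ::
  "(nat \<times> nat \<Rightarrow> nat \<times> nat \<Rightarrow> nat \<times> nat \<Rightarrow> real) \<Rightarrow> (nat \<times> nat \<Rightarrow> complex)
    \<Rightarrow> nat \<times> nat \<Rightarrow> complex" where
  "assemble e W p = (\<Sum>\<alpha>\<in>corners. push \<alpha> (cell_residual e \<alpha> W) p)"

definition grid_op ::
  "(nat \<times> nat) set \<Rightarrow> (nat \<times> nat \<Rightarrow> nat \<times> nat \<Rightarrow> nat \<times> nat \<Rightarrow> real) \<Rightarrow> (nat \<times> nat \<Rightarrow> real)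
    \<Rightarrow> (nat \<times> nat \<Rightarrow> complex) \<Rightarrow> nat \<times> nat \<Rightarrow> complex" where
  "grid_op I e v W p = (if p \<in> I then assemble e W p + of_real (v p) * W p else 0)"

lemma finite_corners: "finite corners" by (simp add: corners_def)

lemma push_range:
  "push \<alpha> G p = 0" if "p \<notin> range (\<lambda>c. c + \<alpha>)"
proof -
  have "p = (p - \<alpha>) + \<alpha>" if "fst \<alpha> \<le> fst p" "snd \<alpha> \<le> snd p"
    using that by (simp add: prod_eq_iff)
  then show ?thesis using that unfolding push_def by (metis rangeI)
qed

lemma push_shift: "push \<alpha> G (c + \<alpha>) = G c"
  by (simp add: push_def)

lemma inj_shift: "inj (\<lambda>c::nat \<times> nat. c + \<alpha>)"
  by (simp add: inj_on_def)

lemma l2_bounded_shift: "l2_bounded (\<lambda>W c. W (c + \<alpha>))" for \<alpha> :: "nat \<times> nat"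
proof (rule l2_boundedI[where C = 1])
  fix W :: "nat \<times> nat \<Rightarrow> complex" assume W: "W \<in> l2 UNIV"
  have sub: "(\<lambda>p. (cmod (W p))\<^sup>2) summable_on range (\<lambda>c. c + \<alpha>)"
    using l2_summable[OF W] summable_on_subset_banach by blast
  then show "(\<lambda>c. W (c + \<alpha>)) \<in> l2 UNIV"
    unfolding summable_on_reindex[OF inj_shift] by (simp add: l2_def o_def)
  have "nsq (\<lambda>c. W (c + \<alpha>)) = (\<Sum>\<^sub>\<infinity>p\<in>range (\<lambda>c. c + \<alpha>). (cmod (W p))\<^sup>2)"
    unfolding infsum_reindex[OF inj_shift] by (simp add: nsq_def o_def)
  also have "\<dots> \<le> nsq W"
    unfolding nsq_def by (rule infsum_mono_neutral[OF sub l2_summable[OF W]]) auto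
  finally show "nsq (\<lambda>c. W (c + \<alpha>)) \<le> 1 * nsq W" by simp
qed

lemma l2_bounded_push: "l2_bounded (push \<alpha>)"
proof (rule l2_boundedI[where C = 1])
  fix G :: "nat \<times> nat \<Rightarrow> complex" assume G: "G \<in> l2 UNIV"
  have "(\<lambda>p. (cmod (push \<alpha> G p))\<^sup>2) summable_on range (\<lambda>c. c + \<alpha>)"
    unfolding summable_on_reindex[OF inj_shift] using l2_summable[OF G] by (simp add: o_def push_shift)
  then have "(\<lambda>p. (cmod (push \<alpha> G p))\<^sup>2) summable_on UNIV"
    by (subst summable_on_cong_neutral[where T = "range (\<lambda>c. c + \<alpha>)"
          and g = "\<lambda>p. (cmod (push \<alpha> G p))\<^sup>2"]) (auto simp: push_range)
  then show "push \<alpha> G \<in> l2 UNIV" by (simp add: l2_def)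
  have "nsq (push \<alpha> G) = (\<Sum>\<^sub>\<infinity>p\<in>range (\<lambda>c. c + \<alpha>). (cmod (push \<alpha> G p))\<^sup>2)"
    unfolding nsq_def by (rule infsum_cong_neutral) (auto simp: push_range)
  also have "\<dots> = nsq G"
    unfolding infsum_reindex[OF inj_shift] by (simp add: nsq_def o_def push_shift)
  finally show "nsq (push \<alpha> G) \<le> 1 * nsq G" by simp
qed

lemma ip_push: "ip (push \<alpha> G) W = ip G (\<lambda>c. W (c + \<alpha>))"
proof -
  have "ip (push \<alpha> G) W = (\<Sum>\<^sub>\<infinity>p\<in>range (\<lambda>c. c + \<alpha>). push \<alpha> G p * cnj (W p))"
    unfolding ip_def by (rule infsum_cong_neutral) (auto simp: push_range)
  also have "\<dots> = ip G (\<lambda>c. W (c + \<alpha>))"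
    unfolding infsum_reindex[OF inj_shift] by (simp add: ip_def o_def push_shift)
  finally show ?thesis .
qed

lemma infsum_finite_sum:
  fixes f :: "'a \<Rightarrow> 'i \<Rightarrow> complex"
  assumes "finite A" "\<And>a. a \<in> A \<Longrightarrow> f a summable_on S"
  shows "(\<Sum>\<^sub>\<infinity>p\<in>S. \<Sum>a\<in>A. f a p) = (\<Sum>a\<in>A. infsum (f a) S)"
proof -
  have "(\<lambda>p. \<Sum>a\<in>A. f a p) summable_on S \<and> ?thesis"
    using assms by (induction A rule: finite_induct) (auto simp: infsum_add summable_on_add)
  then show ?thesis ..
qed

lemma l2_bounded_cell_residual:
  assumes "\<And>c \<alpha> \<beta>. \<alpha> \<in> corners \<Longrightarrow> \<beta> \<in> corners \<Longrightarrow> \<bar>e c \<alpha> \<beta>\<bar> \<le> M" and "\<alpha> \<in> corners"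
  shows "l2_bounded (cell_residual e \<alpha>)"
  unfolding cell_residual_def[abs_def]
  by (intro l2_bounded_sum l2_bounded_mult[OF l2_bounded_shift, where M = M] finite_corners)
    (use assms in auto)

lemma l2_bounded_assemble:
  assumes "\<And>c \<alpha> \<beta>. \<alpha> \<in> corners \<Longrightarrow> \<beta> \<in> corners \<Longrightarrow> \<bar>e c \<alpha> \<beta>\<bar> \<le> M"
  shows "l2_bounded (assemble e)"
  unfolding assemble_def[abs_def]
  by (intro l2_bounded_sum l2_bounded_comp[OF l2_bounded_push l2_bounded_cell_residual[of e M, OF assms]]
      finite_corners)

text \<open>
  Moving each translation to the other argument turns the quadratic form into a sum over cells, where
  each cell contributes the value of a real symmetric matrix on a complex vector and its conjugate.
\<close>

lemma assemble_symmetric: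
  assumes bound: "\<And>c \<alpha> \<beta>. \<alpha> \<in> corners \<Longrightarrow> \<beta> \<in> corners \<Longrightarrow> \<bar>e c \<alpha> \<beta>\<bar> \<le> M"
    and sym: "\<And>c \<alpha> \<beta>. \<alpha> \<in> corners \<Longrightarrow> \<beta> \<in> corners \<Longrightarrow> e c \<alpha> \<beta> = e c \<beta> \<alpha>"
    and W: "W \<in> l2 UNIV"
  shows "Im (ip (assemble e W) W) = 0"
proof -
  define q where "q \<alpha> c = cell_residual e \<alpha> W c * cnj (W (c + \<alpha>))" for \<alpha> c
  have res: "cell_residual e \<alpha> W \<in> l2 UNIV" if "\<alpha> \<in> corners" for \<alpha>
    by (rule l2_boundedD[OF l2_bounded_cell_residual[of e M, OF bound that] W])
  have push: "push \<alpha> (cell_residual e \<alpha> W) \<in> l2 UNIV" if "\<alpha> \<in> corners" for \<alpha>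
    by (rule l2_boundedD[OF l2_bounded_push res[OF that]])
  have shift: "(\<lambda>c. W (c + \<alpha>)) \<in> l2 UNIV" for \<alpha>
    by (rule l2_boundedD[OF l2_bounded_shift W])
  have "ip (assemble e W) W = (\<Sum>\<^sub>\<infinity>p. \<Sum>\<alpha>\<in>corners. push \<alpha> (cell_residual e \<alpha> W) p * cnj (W p))"
    by (simp add: ip_def assemble_def sum_distrib_right)
  also have "\<dots> = (\<Sum>\<alpha>\<in>corners. ip (push \<alpha> (cell_residual e \<alpha> W)) W)"
    unfolding ip_def by (intro infsum_finite_sum finite_corners ip_summable(2)[OF push W])
  also have "\<dots> = (\<Sum>\<alpha>\<in>corners. infsum (q \<alpha>) UNIV)"
    unfolding ip_push by (simp add: ip_def q_def[abs_def])
  also have "\<dots> = (\<Sum>\<^sub>\<infinity>c. \<Sum>\<alpha>\<in>corners. q \<alpha> c)"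
    unfolding q_def by (intro infsum_finite_sum[symmetric] finite_corners ip_summable(2)[OF res shift])
  finally have ip: "ip (assemble e W) W = (\<Sum>\<^sub>\<infinity>c. \<Sum>\<alpha>\<in>corners. q \<alpha> c)" .
  have "cnj (\<Sum>\<alpha>\<in>corners. q \<alpha> c) = (\<Sum>\<alpha>\<in>corners. q \<alpha> c)" for c
  proof -
    have "cnj (\<Sum>\<alpha>\<in>corners. q \<alpha> c)
        = (\<Sum>\<alpha>\<in>corners. \<Sum>\<beta>\<in>corners. of_real (e c \<alpha> \<beta>) * cnj (W (c + \<beta>)) * W (c + \<alpha>))"
      by (simp add: q_def cell_residual_def sum_distrib_right)
    also have "\<dots> = (\<Sum>\<beta>\<in>corners. \<Sum>\<alpha>\<in>corners. of_real (e c \<alpha> \<beta>) * cnj (W (c + \<beta>)) * W (c + \<alpha>))"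
      by (rule sum.swap)
    also have "\<dots> = (\<Sum>\<alpha>\<in>corners. q \<alpha> c)"
      unfolding q_def cell_residual_def sum_distrib_right
      by (intro sum.cong refl) (simp add: sym mult.commute mult.left_commute)
    finally show ?thesis .
  qed
  then have "cnj (ip (assemble e W) W) = ip (assemble e W) W"
    unfolding ip infsum_cnj[symmetric] by simp
  then show ?thesis by (simp add: complex_eq_iff)
qed

lemma assemble_diff: "assemble e (\<lambda>q. u q - v q) p = assemble e u p - assemble e v p"
proof -
  have "cell_residual e \<alpha> (\<lambda>q. u q - v q) = (\<lambda>c. cell_residual e \<alpha> u c - cell_residual e \<alpha> v c)" for \<alpha>
    by (simp add: cell_residual_def[abs_def] right_diff_distrib sum_subtractf)
  then show ?thesis
    unfolding assemble_def sum_subtractf[symmetric] by (intro sum.cong) (auto simp: push_def)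
qed

lemma assemble_tendsto:
  assumes "\<And>q. (\<lambda>n. w n q) \<longlonglongrightarrow> W q"
  shows "(\<lambda>n. assemble e (w n) p) \<longlonglongrightarrow> assemble e W p"
  unfolding assemble_def push_def cell_residual_def
proof (intro tendsto_sum)
  fix \<alpha>
  show "(\<lambda>n. if fst \<alpha> \<le> fst p \<and> snd \<alpha> \<le> snd p
        then \<Sum>\<beta>\<in>corners. complex_of_real (e (p - \<alpha>) \<alpha> \<beta>) * w n (p - \<alpha> + \<beta>) else 0)
    \<longlonglongrightarrow> (if fst \<alpha> \<le> fst p \<and> snd \<alpha> \<le> snd p
        then \<Sum>\<beta>\<in>corners. complex_of_real (e (p - \<alpha>) \<alpha> \<beta>) * W (p - \<alpha> + \<beta>) else 0)"
    by (cases "fst \<alpha> \<le> fst p \<and> snd \<alpha> \<le> snd p") (auto intro!: tendsto_intros assms)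
qed

text \<open>
  Truncation to I does not disturb the symmetry, because the quadratic form is only taken on
  functions that vanish off I.
\<close>

theorem symmetric_grid_op:
  assumes bound: "\<And>c \<alpha> \<beta>. \<alpha> \<in> corners \<Longrightarrow> \<beta> \<in> corners \<Longrightarrow> \<bar>e c \<alpha> \<beta>\<bar> \<le> M"
    and sym: "\<And>c \<alpha> \<beta>. \<alpha> \<in> corners \<Longrightarrow> \<beta> \<in> corners \<Longrightarrow> e c \<alpha> \<beta> = e c \<beta> \<alpha>"
    and v: "\<And>p. p \<in> I \<Longrightarrow> \<bar>v p\<bar> \<le> N"
  shows "symmetric_operator I (grid_op I e v)"
proof
  define mask :: "nat \<times> nat \<Rightarrow> complex" where "mask p = (if p \<in> I then 1 else 0)" for p
  define v' where "v' p = (if p \<in> I then complex_of_real (v p) else 0)" for p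
  have v'N: "cmod (v' p) \<le> \<bar>N\<bar>" for p using v[of p] by (auto simp: v'_def)
  have id: "l2_bounded (\<lambda>W p. W p)" by (rule l2_boundedI[where C = 1]) auto
  have op: "grid_op I e v = (\<lambda>W p. mask p * assemble e W p + v' p * W p)"
    by (auto simp: grid_op_def mask_def v'_def fun_eq_iff)
  show "l2_bounded (grid_op I e v)"
    unfolding op by (intro l2_bounded_add l2_bounded_mult[OF id v'N]
        l2_bounded_mult[OF l2_bounded_assemble[of e M, OF bound], where M = 1]) (auto simp: mask_def)
  show "grid_op I e v (\<lambda>q. u q - w q) p = grid_op I e v u p - grid_op I e v w p" for u w p
    by (simp add: grid_op_def assemble_diff algebra_simps)
  show "(\<lambda>n. grid_op I e v (w n) p) \<longlonglongrightarrow> grid_op I e v W p"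
    if "\<And>q. (\<lambda>n. w n q) \<longlonglongrightarrow> W q" for w W p
    unfolding op by (intro tendsto_intros assemble_tendsto that)
  show "grid_op I e v W p = 0" if "p \<notin> I" for W p using that by (simp add: grid_op_def)
  fix W assume W: "W \<in> l2 I"
  have W': "W \<in> l2 UNIV" by (rule l2_mono[OF W]) auto
  have AW: "assemble e W \<in> l2 UNIV" by (rule l2_boundedD[OF l2_bounded_assemble[of e M, OF bound] W'])
  have "grid_op I e v W p * cnj (W p) = assemble e W p * cnj (W p) + v' p * W p * cnj (W p)" for p
    using l2_supp[OF W, of p] by (cases "p \<in> I") (auto simp: op mask_def algebra_simps)
  then have "ip (grid_op I e v W) W = ip (assemble e W) W + (\<Sum>\<^sub>\<infinity>p. v' p * W p * cnj (W p))"
    unfolding ip_def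
    by (simp add: infsum_add[OF ip_summable(2)[OF AW W] ip_summable(2)[OF l2_mult(1)[OF W v'N] W]])
  moreover have "cnj (\<Sum>\<^sub>\<infinity>p. v' p * W p * cnj (W p)) = (\<Sum>\<^sub>\<infinity>p. v' p * W p * cnj (W p))"
    unfolding infsum_cnj[symmetric] by (rule infsum_cong) (simp add: v'_def)
  ultimately show "Im (ip (grid_op I e v W) W) = 0"
    using assemble_symmetric[of e M, OF bound sym W'] by (simp add: complex_eq_iff)
qed

section \<open>The mesh Hamiltonian as an assembled operator\<close>

text \<open>
  The derivative of the linear basis function of an endpoint of the unit interval.
\<close>

definition corner_sign :: "nat \<Rightarrow> real" where
  "corner_sign a = (if a = 0 then - 1 else 1)"

text \<open>
  The element matrix of the form hbar^2 / 2 times the integral of B grad W . grad \<phi> over one cell,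
  with \<alpha> for the corner of \<phi> and \<beta> for that of W. The diagonal part of B is integrated by the
  trapezoidal rule over the two edges parallel to the derivative, so that only corners of
  a common edge interact there; the mixed terms use the mean gradients. The index c is 0-based, hence the
  successors, and cells outside the strip contribute 0.
\<close>

definition cell_form ::
  "real \<Rightarrow> (nat \<Rightarrow> real) \<Rightarrow> (nat \<Rightarrow> real) \<Rightarrow> nat \<Rightarrow> (real \<times> real \<Rightarrow> real^2^2)
    \<Rightarrow> nat \<times> nat \<Rightarrow> nat \<times> nat \<Rightarrow> nat \<times> nat \<Rightarrow> real" where
  "cell_form hbar x y K B c \<alpha> \<beta> =
    (let j = Suc (fst c); k = Suc (snd c);
         b = (\<lambda>r s. cell_mid x y (\<lambda>z. B z $ r $ s) j k)
     in if k \<le> K then hbar\<^sup>2 / 2 *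
       ((if snd \<alpha> = snd \<beta> then b 1 1 * step y k / (2 * step x j)
            * corner_sign (fst \<alpha>) * corner_sign (fst \<beta>) else 0)
        + (if fst \<alpha> = fst \<beta> then b 2 2 * step x j / (2 * step y k)
            * corner_sign (snd \<alpha>) * corner_sign (snd \<beta>) else 0)
        + (b 1 2 * corner_sign (fst \<alpha>) * corner_sign (snd \<beta>)
           + b 2 1 * corner_sign (snd \<alpha>) * corner_sign (fst \<beta>)) / 4)
       else 0)"

lemma half_step_fwd_diff:
  fixes w :: "nat \<Rightarrow> complex"
  assumes "half_step s j \<noteq> 0"
  shows "of_real (half_step s j) * fwd_diff s w j = w (Suc j) - w j"
  using assms by (simp add: fwd_diff_def scaleR_conv_of_real)

lemma half_step_fwd_avg:
  fixes w :: "nat \<Rightarrow> complex"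
  assumes "half_step s j \<noteq> 0"
  shows "of_real (half_step s j) * fwd_avg s w j
    = (of_real (step s j) * w j + of_real (step s (Suc j)) * w (Suc j)) / 2"
  using assms by (simp add: fwd_avg_def scaleR_conv_of_real field_simps)

lemma half_step_fwd_avg_real:
  fixes w :: "nat \<Rightarrow> real"
  assumes "half_step s j \<noteq> 0"
  shows "half_step s j * fwd_avg s w j = (step s j * w j + step s (Suc j) * w (Suc j)) / 2"
  using assms by (simp add: fwd_avg_def field_simps)

text \<open>
  Each of the four terms of the Hamiltonian at the node (Suc j, Suc k), multiplied by the node weight,
  becomes a sum over the four adjacent cells: the half steps cancel against the denominators of the
  forward differences and averages.
\<close>

context
  fixes x y :: "nat \<Rightarrow> real" and j k :: nat and W :: "nat \<Rightarrow> nat \<Rightarrow> complex"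
  assumes pos: "step x (Suc j) > 0" "step x (Suc (Suc j)) > 0"
    "step y (Suc k) > 0" "step y (Suc (Suc k)) > 0"
begin

lemma half_steps: "half_step x (Suc j) \<noteq> 0" "half_step y (Suc k) \<noteq> 0"
  using pos by (simp_all add: half_step_def)

lemma flux_11:
  "of_real (half_step x (Suc j)) * of_real (half_step y (Suc k)) *
     in_x (fwd_diff x) (pw_scale (in_y (fwd_avg y) b) (in_x (bwd_diff x) W)) (Suc j) (Suc k)
   = of_real ((step y (Suc k) * b (Suc (Suc j)) (Suc k)
        + step y (Suc (Suc k)) * b (Suc (Suc j)) (Suc (Suc k))) / 2)
       * ((W (Suc (Suc j)) (Suc k) - W (Suc j) (Suc k)) / of_real (step x (Suc (Suc j))))
     - of_real ((step y (Suc k) * b (Suc j) (Suc k)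
        + step y (Suc (Suc k)) * b (Suc j) (Suc (Suc k))) / 2)
       * ((W (Suc j) (Suc k) - W j (Suc k)) / of_real (step x (Suc j)))"
proof -
  have "of_real (half_step x (Suc j)) * of_real (half_step y (Suc k)) *
     in_x (fwd_diff x) (pw_scale (in_y (fwd_avg y) b) (in_x (bwd_diff x) W)) (Suc j) (Suc k)
   = of_real (half_step y (Suc k) * fwd_avg y (b (Suc (Suc j))) (Suc k))
        * bwd_diff x (\<lambda>i. W i (Suc k)) (Suc (Suc j))
     - of_real (half_step y (Suc k) * fwd_avg y (b (Suc j)) (Suc k))
        * bwd_diff x (\<lambda>i. W i (Suc k)) (Suc j)"
    unfolding in_x_def mult.assoc
      mult.left_commute[of "complex_of_real (half_step x (Suc j))" "complex_of_real (half_step y (Suc k))"]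
      half_step_fwd_diff[OF half_steps(1)]
    by (simp add: pw_scale_def in_y_def in_x_def scaleR_conv_of_real right_diff_distrib)
  then show ?thesis
    unfolding half_step_fwd_avg_real[OF half_steps(2)]
    by (simp add: bwd_diff_def scaleR_conv_of_real field_simps)
qed

lemma flux_22:
  "of_real (half_step x (Suc j)) * of_real (half_step y (Suc k)) *
     in_y (fwd_diff y) (pw_scale (in_x (fwd_avg x) b) (in_y (bwd_diff y) W)) (Suc j) (Suc k)
   = of_real ((step x (Suc j) * b (Suc j) (Suc (Suc k))
        + step x (Suc (Suc j)) * b (Suc (Suc j)) (Suc (Suc k))) / 2)
       * ((W (Suc j) (Suc (Suc k)) - W (Suc j) (Suc k)) / of_real (step y (Suc (Suc k))))
     - of_real ((step x (Suc j) * b (Suc j) (Suc k)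
        + step x (Suc (Suc j)) * b (Suc (Suc j)) (Suc k)) / 2)
       * ((W (Suc j) (Suc k) - W (Suc j) k) / of_real (step y (Suc k)))"
proof -
  have "of_real (half_step x (Suc j)) * of_real (half_step y (Suc k)) *
     in_y (fwd_diff y) (pw_scale (in_x (fwd_avg x) b) (in_y (bwd_diff y) W)) (Suc j) (Suc k)
   = of_real (half_step x (Suc j) * fwd_avg x (\<lambda>i. b i (Suc (Suc k))) (Suc j))
        * bwd_diff y (W (Suc j)) (Suc (Suc k))
     - of_real (half_step x (Suc j) * fwd_avg x (\<lambda>i. b i (Suc k)) (Suc j))
        * bwd_diff y (W (Suc j)) (Suc k)"
    unfolding in_y_def mult.assoc half_step_fwd_diff[OF half_steps(2)]
    by (simp add: pw_scale_def in_y_def in_x_def scaleR_conv_of_real right_diff_distrib)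
  then show ?thesis
    unfolding half_step_fwd_avg_real[OF half_steps(1)]
    by (simp add: bwd_diff_def scaleR_conv_of_real field_simps)
qed

lemma flux_12:
  fixes b :: "nat \<Rightarrow> nat \<Rightarrow> real"
  defines "g \<equiv> \<lambda>j k. of_real (b (Suc j) (Suc k))
    * (W j (Suc k) - W j k + W (Suc j) (Suc k) - W (Suc j) k) / 4"
  shows "of_real (half_step x (Suc j)) * of_real (half_step y (Suc k)) *
     in_x (fwd_diff x) (in_y (fwd_avg y) (pw_scale b (in_x bwd_avg (in_y (bwd_diff y) W))))
       (Suc j) (Suc k)
   = g (Suc j) k + g (Suc j) (Suc k) - g j k - g j (Suc k)"
proof -
  have "of_real (half_step x (Suc j)) * of_real (half_step y (Suc k)) *
     in_x (fwd_diff x) (in_y (fwd_avg y) (pw_scale b (in_x bwd_avg (in_y (bwd_diff y) W))))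
       (Suc j) (Suc k)
   = of_real (half_step y (Suc k)) *
       fwd_avg y (pw_scale b (in_x bwd_avg (in_y (bwd_diff y) W)) (Suc (Suc j))) (Suc k)
     - of_real (half_step y (Suc k)) *
       fwd_avg y (pw_scale b (in_x bwd_avg (in_y (bwd_diff y) W)) (Suc j)) (Suc k)"
    unfolding in_x_def[of "fwd_diff x"] mult.assoc
      mult.left_commute[of "complex_of_real (half_step x (Suc j))" "complex_of_real (half_step y (Suc k))"]
      half_step_fwd_diff[OF half_steps(1)]
    by (simp add: in_y_def right_diff_distrib)
  moreover have "of_real (step y (Suc l)) * pw_scale b (in_x bwd_avg (in_y (bwd_diff y) W)) (Suc i) (Suc l)
      = 2 * g i l" if "l = k \<or> l = Suc k" for i l
    using pos that by (auto simp: pw_scale_def in_x_def in_y_def bwd_avg_def bwd_diff_def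
        scaleR_conv_of_real g_def field_simps)
  ultimately show ?thesis
    unfolding half_step_fwd_avg[OF half_steps(2)] by (simp add: add_divide_distrib)
qed

lemma flux_21:
  fixes b :: "nat \<Rightarrow> nat \<Rightarrow> real"
  defines "g \<equiv> \<lambda>j k. of_real (b (Suc j) (Suc k))
    * (W (Suc j) k - W j k + W (Suc j) (Suc k) - W j (Suc k)) / 4"
  shows "of_real (half_step x (Suc j)) * of_real (half_step y (Suc k)) *
     in_x (fwd_avg x) (in_y (fwd_diff y) (pw_scale b (in_x (bwd_diff x) (in_y bwd_avg W))))
       (Suc j) (Suc k)
   = g j (Suc k) + g (Suc j) (Suc k) - g j k - g (Suc j) k"
proof -
  have "of_real (half_step x (Suc j)) * of_real (half_step y (Suc k)) *
     in_x (fwd_avg x) (in_y (fwd_diff y) (pw_scale b (in_x (bwd_diff x) (in_y bwd_avg W))))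
       (Suc j) (Suc k)
   = (of_real (step x (Suc j)) * (of_real (half_step y (Suc k)) * 
        fwd_diff y (pw_scale b (in_x (bwd_diff x) (in_y bwd_avg W)) (Suc j)) (Suc k))
     + of_real (step x (Suc (Suc j))) * (of_real (half_step y (Suc k)) * 
        fwd_diff y (pw_scale b (in_x (bwd_diff x) (in_y bwd_avg W)) (Suc (Suc j))) (Suc k))) / 2"
    unfolding in_x_def[of "fwd_avg x"] mult.assoc
      mult.left_commute[of "complex_of_real (half_step x (Suc j))" "complex_of_real (half_step y (Suc k))"]
      half_step_fwd_avg[OF half_steps(1)]
    by (simp add: in_y_def algebra_simps)
  moreover have "of_real (step x (Suc i)) * pw_scale b (in_x (bwd_diff x) (in_y bwd_avg W)) (Suc i) (Suc l)
      = 2 * g i l" if "i = j \<or> i = Suc j" for i l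
    using pos that by (auto simp: pw_scale_def in_x_def in_y_def bwd_avg_def bwd_diff_def
        scaleR_conv_of_real g_def field_simps)
  ultimately show ?thesis
    unfolding half_step_fwd_diff[OF half_steps(2)] right_diff_distrib
    by (simp add: add_divide_distrib diff_divide_distrib)
qed

text \<open>
  This is summation by parts in disguise: the weighted difference operator is the gradient of a sum of
  symmetric cell forms.
\<close>

lemma mesh_hamiltonian_assembled:
  assumes K: "Suc k < K"
  shows "of_real (half_step x (Suc j) * half_step y (Suc k)) * mesh_hamiltonian hbar x y B W (Suc j) (Suc k)
    = assemble (cell_form hbar x y K B) (\<lambda>(i, l). W i l) (Suc j, Suc k)"
proof -
  define b where "b r s = cell_mid x y (\<lambda>z. B z $ r $ s)" for r s
  have "of_real (half_step x (Suc j) * half_step y (Suc k)) * mesh_hamiltonian hbar x y B W (Suc j) (Suc k)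
    = - of_real (hbar\<^sup>2 / 2) *
      (of_real (half_step x (Suc j)) * of_real (half_step y (Suc k)) *
     in_x (fwd_diff x) (pw_scale (in_y (fwd_avg y) (b 1 1)) (in_x (bwd_diff x) W)) (Suc j) (Suc k)
     + of_real (half_step x (Suc j)) * of_real (half_step y (Suc k)) *
     in_x (fwd_diff x) (in_y (fwd_avg y) (pw_scale (b 1 2) (in_x bwd_avg (in_y (bwd_diff y) W))))
       (Suc j) (Suc k)
     + of_real (half_step x (Suc j)) * of_real (half_step y (Suc k)) *
     in_x (fwd_avg x) (in_y (fwd_diff y) (pw_scale (b 2 1) (in_x (bwd_diff x) (in_y bwd_avg W))))
       (Suc j) (Suc k)
     + of_real (half_step x (Suc j)) * of_real (half_step y (Suc k)) *
     in_y (fwd_diff y) (pw_scale (in_x (fwd_avg x) (b 2 2)) (in_y (bwd_diff y) W)) (Suc j) (Suc k))"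
    unfolding mesh_hamiltonian_def Let_def b_def
    by (simp add: scaleR_conv_of_real algebra_simps)
  also have "\<dots> = assemble (cell_form hbar x y K B) (\<lambda>(i, l). W i l) (Suc j, Suc k)"
    unfolding flux_11 flux_12 flux_21 flux_22
    using K by (simp add: assemble_def corners_def push_def cell_residual_def cell_form_def Let_def
        corner_sign_def b_def[symmetric] diff_divide_distrib add_divide_distrib algebra_simps)
  finally show ?thesis .
qed

end

section \<open>Mesh functions as square-summable families\<close>

definition interior_nodes :: "nat \<Rightarrow> (nat \<times> nat) set" where
  "interior_nodes K = {1..} \<times> {1..<K}"

text \<open>
  Only values at interior nodes enter the norms, and values beyond the upper boundary are
  arbitrary; cutting them off yields a function to which the theory of l2 applies.
\<close>

definition zero_ext :: "nat \<Rightarrow> (nat \<Rightarrow> nat \<Rightarrow> complex) \<Rightarrow> nat \<times> nat \<Rightarrow> complex" where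
  "zero_ext K W p = (if p \<in> interior_nodes K then W (fst p) (snd p) else 0)"

definition node_weight :: "(nat \<Rightarrow> real) \<Rightarrow> (nat \<Rightarrow> real) \<Rightarrow> nat \<times> nat \<Rightarrow> real" where
  "node_weight x y p = half_step x (fst p) * half_step y (snd p)"

lemma zero_ext_node:
  assumes "zero_on_boundary K W" "l \<le> K"
  shows "zero_ext K W (i, l) = W i l"
  using assms by (auto simp: zero_ext_def interior_nodes_def zero_on_boundary_def not_less not_le)

lemma summable_on_interior_iff:
  "(\<lambda>p. (cmod (zero_ext K W p))\<^sup>2) summable_on UNIV
    \<longleftrightarrow> (\<lambda>(j, k). (cmod (W j k))\<^sup>2) summable_on interior_nodes K"
  by (rule summable_on_cong_neutral) (auto simp: zero_ext_def)

lemma H_space_imp_l2: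
  assumes y: "\<And>k. k \<in> {1..<K} \<Longrightarrow> half_step y k > 0" and W: "W \<in> H_space y K"
  shows "zero_ext K W \<in> l2 (interior_nodes K)"
proof -
  define c where "c = Min (insert 1 (half_step y ` {1..<K}))"
  have c: "c > 0" using y by (auto simp: c_def)
  have ck: "c \<le> half_step y k" if "k \<in> {1..<K}" for k
    unfolding c_def using that by (intro Min_le) auto
  have "(\<lambda>p. (cmod (W (fst p) (snd p)))\<^sup>2 * half_step y (snd p)) summable_on interior_nodes K"
    unfolding interior_nodes_def
  proof (rule summable_on_SigmaI)
    show "(\<lambda>j. \<Sum>k\<in>{1..<K}. (cmod (W j k))\<^sup>2 * half_step y k) summable_on {1..}"
      using W by (simp add: H_space_def)
    show "((\<lambda>k. (cmod (W (fst (j, k)) (snd (j, k))))\<^sup>2 * half_step y (snd (j, k)))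
        has_sum (\<Sum>k\<in>{1..<K}. (cmod (W j k))\<^sup>2 * half_step y k)) {1..<K}" for j
      by (simp add: has_sum_finite)
    show "0 \<le> (cmod (W (fst (j, k)) (snd (j, k))))\<^sup>2 * half_step y (snd (j, k))"
      if "k \<in> {1..<K}" for j k using y[OF that] by simp
  qed
  then have s: "(\<lambda>p. inverse c * ((cmod (W (fst p) (snd p)))\<^sup>2 * half_step y (snd p)))
      summable_on interior_nodes K" by (rule summable_on_cmult_right)
  have "(\<lambda>(j, k). (cmod (W j k))\<^sup>2) summable_on interior_nodes K"
  proof (rule summable_on_comparison_test[OF s])
    fix p assume "p \<in> interior_nodes K"
    then have "c * (cmod (W (fst p) (snd p)))\<^sup>2 \<le> half_step y (snd p) * (cmod (W (fst p) (snd p)))\<^sup>2"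
      by (intro mult_right_mono ck) (auto simp: interior_nodes_def)
    then show "(case p of (j, k) \<Rightarrow> (cmod (W j k))\<^sup>2)
        \<le> inverse c * ((cmod (W (fst p) (snd p)))\<^sup>2 * half_step y (snd p))"
      using c by (cases p) (simp add: field_simps)
  qed auto
  then show ?thesis
    unfolding l2_def using summable_on_interior_iff[of K W] by (auto simp: zero_ext_def)
qed

lemma l2_imp_H_space:
  assumes W: "zero_ext K W \<in> l2 (interior_nodes K)" and zero: "zero_on_boundary K W"
  shows "W \<in> H_space y K"
proof -
  define M where "M = Max (insert 0 (half_step y ` {1..<K}))"
  have col: "(\<lambda>j. (cmod (W j k))\<^sup>2 * half_step y k) summable_on {1..}" if k: "k \<in> {1..<K}" for k
  proof -
    have "(\<lambda>(j, k). (cmod (W j k))\<^sup>2) summable_on interior_nodes K"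
      using l2_summable[OF W] unfolding summable_on_interior_iff .
    then have "(\<lambda>(j, k). (cmod (W j k))\<^sup>2) summable_on (\<lambda>j. (j, k)) ` {1..}"
      using k by (elim summable_on_subset_banach) (auto simp: interior_nodes_def)
    then have "(\<lambda>j. (cmod (W j k))\<^sup>2) summable_on {1..}"
      by (subst (asm) summable_on_reindex) (auto simp: inj_on_def o_def)
    then show ?thesis by (rule summable_on_cmult_left)
  qed
  have "(\<lambda>j. \<Sum>k\<in>S. (cmod (W j k))\<^sup>2 * half_step y k) summable_on {1..}"
    if "finite S" "S \<subseteq> {1..<K}" for S
    using that
  proof (induction S rule: finite_induct)
    case (insert k S)
    then show ?case using summable_on_add[OF col[of k]] by simp
  qed simp
  then show ?thesis using zero by (simp add: H_space_def)
qed

text \<open>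
  Weights of the norm and factors such as the square root of the density are moved into one l2
  function, so that norms on the mesh become unweighted ones.
\<close>

lemma H_norm_scaled:
  assumes W: "zero_ext K W \<in> l2 (interior_nodes K)"
    and weight: "\<And>p. p \<in> interior_nodes K \<Longrightarrow> 0 \<le> node_weight x y p"
    and bound: "\<And>p. p \<in> interior_nodes K \<Longrightarrow> sqrt (node_weight x y p) * \<bar>s (fst p) (snd p)\<bar> \<le> M"
  shows "(\<lambda>p. of_real (sqrt (node_weight x y p) * s (fst p) (snd p)) * zero_ext K W p)
      \<in> l2 (interior_nodes K)"
    and "H_norm x y K (\<lambda>j k. s j k *\<^sub>R W j k)
      = sqrt (nsq (\<lambda>p. of_real (sqrt (node_weight x y p) * s (fst p) (snd p)) * zero_ext K W p))"
proof -
  let ?V = "(\<lambda>p. of_real (sqrt (node_weight x y p) * s (fst p) (snd p)) * zero_ext K W p)"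
  define V where "V = ?V"
  define g where "g = (\<lambda>j k. (s j k *\<^sub>R W j k) * cnj (s j k *\<^sub>R W j k)
      * of_real (half_step x j) * of_real (half_step y k))"
  define m where "m p = (if p \<in> interior_nodes K
      then complex_of_real (sqrt (node_weight x y p) * s (fst p) (snd p)) else 0)" for p
  have "(\<lambda>p. m p * zero_ext K W p) \<in> l2 (interior_nodes K)"
    by (rule l2_mult(1)[OF W, of _ "\<bar>M\<bar>"])
      (use bound weight in \<open>fastforce simp: m_def norm_mult abs_mult\<close>)
  moreover have V_m: "V = (\<lambda>p. m p * zero_ext K W p)"
    by (auto simp: V_def m_def zero_ext_def fun_eq_iff)
  ultimately have V: "V \<in> l2 (interior_nodes K)" by simp
  then show "?V \<in> l2 (interior_nodes K)" by (simp add: V_def)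
  have g_V: "g j k = of_real ((cmod (V (j, k)))\<^sup>2)" if "(j, k) \<in> interior_nodes K" for j k
  proof -
    have "of_real ((cmod (V (j, k)))\<^sup>2) = of_real ((sqrt (node_weight x y (j, k)))\<^sup>2 * (s j k)\<^sup>2) * (W j k * cnj (W j k))"
      using that 
      by (simp add: V_def zero_ext_def norm_mult power_mult_distrib complex_norm_square[symmetric])
    then show ?thesis using weight[OF that]
      by (simp add: g_def node_weight_def scaleR_conv_of_real power2_eq_square)
  qed
  have sV: "(\<lambda>p. complex_of_real ((cmod (V p))\<^sup>2)) summable_on UNIV"
    using summable_on_of_real[OF l2_summable[OF V]] by simp
  have "(\<lambda>(j, k). g j k) summable_on interior_nodes K"
    using sV by (rule summable_on_cong_neutral[THEN iffD1, rotated -1])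
      (auto simp: g_V l2_supp[OF V])
  then have "H_inner x y K (\<lambda>j k. s j k *\<^sub>R W j k) (\<lambda>j k. s j k *\<^sub>R W j k)
      = infsum (\<lambda>(j, k). g j k) (interior_nodes K)"
    unfolding H_inner_def interior_nodes_def
    by (subst infsum_Sigma'_banach[symmetric]) (auto simp: g_def)
  also have "\<dots> = (\<Sum>\<^sub>\<infinity>p. of_real ((cmod (V p))\<^sup>2))"
    by (rule infsum_cong_neutral) (auto simp: g_V l2_supp[OF V])
  also have "\<dots> = of_real (nsq V)"
    unfolding nsq_def
    by (rule infsumI) (intro has_sum_of_real has_sum_infsum l2_summable[OF V])
  finally show "H_norm x y K (\<lambda>j k. s j k *\<^sub>R W j k) = sqrt (nsq ?V)"
    by (simp add: H_norm_def V_def)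
qed

lemma H_norm_cong:
  assumes "\<And>j k. j \<ge> 1 \<Longrightarrow> k \<in> {1..<K} \<Longrightarrow> cmod (U j k) = cmod (W j k)"
  shows "H_norm x y K U = H_norm x y K W"
  unfolding H_norm_def H_inner_def
  by (intro arg_cong[of _ _ "\<lambda>z. sqrt (Re z)"] infsum_cong sum.cong refl)
    (use assms in \<open>auto simp: complex_norm_square[symmetric]\<close>)

lemma H_space_modulus:
  assumes "U \<in> H_space y K" "zero_on_boundary K W"
    and "\<And>j k. j \<ge> 1 \<Longrightarrow> k \<in> {1..<K} \<Longrightarrow> cmod (W j k) = cmod (U j k)"
  shows "W \<in> H_space y K"
proof -
  have "(\<lambda>j. \<Sum>k\<in>{1..<K}. (cmod (W j k))\<^sup>2 * half_step y k) summable_on {1..}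
      \<longleftrightarrow> (\<lambda>j. \<Sum>k\<in>{1..<K}. (cmod (U j k))\<^sup>2 * half_step y k) summable_on {1..}"
    by (intro summable_on_cong sum.cong refl) (simp add: assms(3))
  then show ?thesis using assms(1,2) by (simp add: H_space_def)
qed

text \<open>
  Cells inside the strip only see nodes up to the boundary, where W vanishes anyway, and the others
  have a zero cell form.
\<close>

lemma assemble_zero_ext:
  assumes "zero_on_boundary K W"
  shows "assemble (cell_form hbar x y K B) (\<lambda>(i, l). W i l) = assemble (cell_form hbar x y K B) (zero_ext K W)"
proof -
  have "cell_residual (cell_form hbar x y K B) \<alpha> (\<lambda>(i, l). W i l)
      = cell_residual (cell_form hbar x y K B) \<alpha> (zero_ext K W)" for \<alpha>
    unfolding cell_residual_def
  proof (intro ext sum.cong refl)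
    fix c \<beta> assume \<beta>: "\<beta> \<in> corners"
    show "of_real (cell_form hbar x y K B c \<alpha> \<beta>) * (case c + \<beta> of (i, l) \<Rightarrow> W i l)
        = of_real (cell_form hbar x y K B c \<alpha> \<beta>) * zero_ext K W (c + \<beta>)"
    proof (cases "Suc (snd c) \<le> K")
      case True
      then have "snd (c + \<beta>) \<le> K" using \<beta> by (auto simp: corners_def)
      then show ?thesis using zero_ext_node[OF assms, of "snd (c + \<beta>)" "fst (c + \<beta>)"]
        by (simp add: case_prod_beta del: fst_add snd_add)
    qed (simp add: cell_form_def)
  qed
  then show ?thesis by (simp add: assemble_def[abs_def])
qed

section \<open>One time step of the scheme\<close>

text \<open>
  What the analysis of a time step uses about the mesh and the coefficients. The bounds are uniform in
  the infinite direction.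
\<close>

locale mesh_data =
  fixes hbar :: real and x y :: "nat \<Rightarrow> real" and K :: nat
    and \<rho> :: "real \<times> real \<Rightarrow> real" and B :: "real \<times> real \<Rightarrow> real^2^2" and Vt :: "real \<Rightarrow> real"
  assumes hbar: "hbar > 0"
    and step_x: "step x (Suc j) > 0"
    and step_y: "k < K \<Longrightarrow> step y (Suc k) > 0"
    and weight_bounds: "\<exists>c>0. \<exists>M. \<forall>p\<in>interior_nodes K. c \<le> node_weight x y p \<and> node_weight x y p \<le> M"
    and density_bounds: "\<exists>c>0. \<exists>M. \<forall>p\<in>interior_nodes K.
      c \<le> cell_avg x y \<rho> (fst p) (snd p) \<and> cell_avg x y \<rho> (fst p) (snd p) \<le> M"
    and potential_bound: "\<exists>M. \<forall>p\<in>interior_nodes K. \<bar>aux_pot x Vt (fst p)\<bar> \<le> M"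
    and cell_form_bound: "\<exists>M. \<forall>c. \<forall>\<alpha>\<in>corners. \<forall>\<beta>\<in>corners. \<bar>cell_form hbar x y K B c \<alpha> \<beta>\<bar> \<le> M"
    and cell_form_sym: "cell_form hbar x y K B c \<alpha> \<beta> = cell_form hbar x y K B c \<beta> \<alpha>"
begin

abbreviation I where "I \<equiv> interior_nodes K"

definition \<mu> where "\<mu> = node_weight x y"
definition r where "r p = cell_avg x y \<rho> (fst p) (snd p)"

definition weighted_op where
  "weighted_op = grid_op I (cell_form hbar x y K B) (\<lambda>p. \<mu> p * aux_pot x Vt (fst p))"

text \<open>
  The norm in the stability bound; its square is the mass that is conserved.
\<close>

definition mass :: "(nat \<Rightarrow> nat \<Rightarrow> complex) \<Rightarrow> real" where
  "mass U = H_norm x y K (\<lambda>j k. sqrt (cell_avg x y \<rho> j k) *\<^sub>R U j k)"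

definition force :: "(nat \<Rightarrow> nat \<Rightarrow> complex) \<Rightarrow> real" where
  "force G = H_norm x y K (\<lambda>j k. G j k /\<^sub>R sqrt (cell_avg x y \<rho> j k))"

definition schrodinger_step where
  "schrodinger_step \<tau> G U V \<longleftrightarrow> (\<forall>j\<ge>1. \<forall>k\<in>{1..<K}.
     \<i> * of_real hbar * of_real (cell_avg x y \<rho> j k) * ((V j k - U j k) / of_real \<tau>) =
       mesh_hamiltonian hbar x y B (\<lambda>i l. (V i l + U i l) / 2) j k
       + of_real (aux_pot x Vt j) * ((V j k + U j k) / 2) + G j k)"

lemma half_step_y: "k \<in> {1..<K} \<Longrightarrow> half_step y k > 0"
  using step_y[of "k - 1"] step_y[of k] by (cases k) (auto simp: half_step_def)

lemma \<mu>_bounds: obtains c M where "c > 0" "\<And>p. p \<in> I \<Longrightarrow> c \<le> \<mu> p" "\<And>p. p \<in> I \<Longrightarrow> \<mu> p \<le> M"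
  using weight_bounds unfolding \<mu>_def by blast

lemma r_bounds: obtains c M where "c > 0" "\<And>p. p \<in> I \<Longrightarrow> c \<le> r p" "\<And>p. p \<in> I \<Longrightarrow> r p \<le> M"
  using density_bounds unfolding r_def by blast

lemma \<mu>_pos: "p \<in> I \<Longrightarrow> \<mu> p > 0" using \<mu>_bounds by (metis less_le_trans)

lemma r_pos: "p \<in> I \<Longrightarrow> r p > 0" using r_bounds by (metis less_le_trans)

definition cn_weight where "cn_weight \<tau> p = hbar / \<tau> * (\<mu> p * r p)"

lemma cn_weight_bounds:
  assumes "\<tau> > 0"
  obtains c M where "c > 0" "\<And>p. p \<in> I \<Longrightarrow> c \<le> cn_weight \<tau> p" "\<And>p. p \<in> I \<Longrightarrow> cn_weight \<tau> p \<le> M"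
proof -
  obtain c M where c: "c > 0" "\<And>p. p \<in> I \<Longrightarrow> c \<le> \<mu> p" "\<And>p. p \<in> I \<Longrightarrow> \<mu> p \<le> M"
    using \<mu>_bounds by metis
  obtain c' M' where c': "c' > 0" "\<And>p. p \<in> I \<Longrightarrow> c' \<le> r p" "\<And>p. p \<in> I \<Longrightarrow> r p \<le> M'"
    using r_bounds by metis
  show thesis
  proof (rule that[of "hbar / \<tau> * (c * c')" "hbar / \<tau> * (M * M')"])
    show "hbar / \<tau> * (c * c') > 0" using assms hbar c c' by simp
    fix p assume p: "p \<in> I"
    show "hbar / \<tau> * (c * c') \<le> cn_weight \<tau> p" unfolding cn_weight_def
      using assms hbar c(1) c'(1) c(2)[OF p] c'(2)[OF p] by (intro mult_left_mono mult_mono) auto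
    show "cn_weight \<tau> p \<le> hbar / \<tau> * (M * M')" unfolding cn_weight_def
      using assms hbar c(1) c'(1) c(2,3)[OF p] c'(2,3)[OF p] by (intro mult_left_mono mult_mono) auto
  qed
qed

sublocale op: symmetric_operator I weighted_op
proof -
  obtain M where M: "\<And>c \<alpha> \<beta>. \<alpha> \<in> corners \<Longrightarrow> \<beta> \<in> corners \<Longrightarrow> \<bar>cell_form hbar x y K B c \<alpha> \<beta>\<bar> \<le> M"
    using cell_form_bound by blast
  obtain N where N: "\<And>p. p \<in> I \<Longrightarrow> \<bar>aux_pot x Vt (fst p)\<bar> \<le> N" using potential_bound by blast
  obtain c L where L: "c > 0" "\<And>p. p \<in> I \<Longrightarrow> c \<le> \<mu> p" "\<And>p. p \<in> I \<Longrightarrow> \<mu> p \<le> L" using \<mu>_bounds by metis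
  have "\<bar>\<mu> p * aux_pot x Vt (fst p)\<bar> \<le> L * N" if "p \<in> I" for p
    unfolding abs_mult using L(1) L(2,3)[OF that] N[OF that] by (intro mult_mono) auto
  then show "symmetric_operator I weighted_op"
    unfolding weighted_op_def by (intro symmetric_grid_op[of _ M] M cell_form_sym)
qed

lemma weighted_op_eq:
  assumes "zero_on_boundary K W" "j \<ge> 1" "k \<in> {1..<K}"
  shows "weighted_op (zero_ext K W) (j, k)
    = of_real (\<mu> (j, k)) * (mesh_hamiltonian hbar x y B W j k + of_real (aux_pot x Vt j) * W j k)"
proof -
  obtain j' k' where jk: "j = Suc j'" "k = Suc k'" using assms(2,3) by (cases j; cases k) auto
  have "assemble (cell_form hbar x y K B) (zero_ext K W) (j, k)
      = of_real (\<mu> (j, k)) * mesh_hamiltonian hbar x y B W j k"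
    unfolding assemble_zero_ext[OF assms(1), symmetric] jk \<mu>_def node_weight_def fst_conv snd_conv
    by (rule mesh_hamiltonian_assembled[symmetric])
      (use assms(3) jk in \<open>auto intro!: step_x step_y\<close>)
  then show ?thesis using assms
    by (simp add: weighted_op_def grid_op_def interior_nodes_def zero_ext_def algebra_simps)
qed

text \<open>
  Multiplication by the positive node weight turns the equation of the scheme into the abstract
  Crank-Nicolson step with a symmetric operator.
\<close>

lemma schrodinger_step_iff:
  assumes "zero_on_boundary K U" "zero_on_boundary K V"
  shows "schrodinger_step \<tau> G U V \<longleftrightarrow>
    op.cn_step (cn_weight \<tau>) (\<lambda>p. of_real (\<mu> p) * zero_ext K G p)
      (zero_ext K U) (zero_ext K V)"
proof -
  define W where "W = (\<lambda>i l. (V i l + U i l) / 2)"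
  have W: "zero_on_boundary K W" using assms by (auto simp: W_def zero_on_boundary_def)
  have ext: "(\<lambda>q. (zero_ext K V q + zero_ext K U q) / 2) = zero_ext K W"
    by (auto simp: zero_ext_def W_def fun_eq_iff)
  have "(\<i> * of_real hbar * of_real (cell_avg x y \<rho> j k) * ((V j k - U j k) / of_real \<tau>) =
       mesh_hamiltonian hbar x y B W j k + of_real (aux_pot x Vt j) * W j k + G j k) \<longleftrightarrow>
    \<i> * of_real (cn_weight \<tau> (j, k)) * (zero_ext K V (j, k) - zero_ext K U (j, k))
      = weighted_op (zero_ext K W) (j, k) + of_real (\<mu> (j, k)) * zero_ext K G (j, k)"
    (is "?l = ?r \<longleftrightarrow> ?l' = ?r'")
    if jk: "j \<ge> 1" "k \<in> {1..<K}" for j k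
  proof -
    have I: "(j, k) \<in> I" using jk by (simp add: interior_nodes_def)
    have "?l' = of_real (\<mu> (j, k)) * ?l" using I by (simp add: zero_ext_def r_def cn_weight_def)
    moreover have "?r' = of_real (\<mu> (j, k)) * ?r"
      using I by (simp add: weighted_op_eq[OF W jk] zero_ext_def algebra_simps)
    moreover have "complex_of_real (\<mu> (j, k)) \<noteq> 0" using \<mu>_pos[OF I] by simp
    ultimately show ?thesis by (simp only: mult_cancel_left simp_thms)
  qed
  then show ?thesis
    unfolding schrodinger_step_def op.cn_step_def ext W_def[symmetric]
    by (auto simp: interior_nodes_def W_def)
qed

lemma H_l2: "W \<in> H_space y K \<Longrightarrow> zero_ext K W \<in> l2 I"
  by (rule H_space_imp_l2[OF half_step_y])

lemma H_zero: "W \<in> H_space y K \<Longrightarrow> zero_on_boundary K W"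
  by (simp add: H_space_def)

lemma weighted_l2:
  assumes "G \<in> H_space y K" shows "(\<lambda>p. of_real (\<mu> p) * zero_ext K G p) \<in> l2 I"
proof -
  obtain c M where M: "c > 0" "\<And>p. p \<in> I \<Longrightarrow> c \<le> \<mu> p" "\<And>p. p \<in> I \<Longrightarrow> \<mu> p \<le> M" using \<mu>_bounds by metis
  have "(\<lambda>p. (if p \<in> I then of_real (\<mu> p) else 0) * zero_ext K G p) \<in> l2 I"
    by (rule l2_mult(1)[OF H_l2[OF assms], where M = "\<bar>M\<bar>"]) (use M in fastforce)
  also have "(\<lambda>p. (if p \<in> I then of_real (\<mu> p) else 0) * zero_ext K G p) = (\<lambda>p. of_real (\<mu> p) * zero_ext K G p)"
    by (auto simp: zero_ext_def fun_eq_iff)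
  finally show ?thesis .
qed

lemma step_exists:
  assumes \<tau>: "\<tau> > 0" and G: "G \<in> H_space y K" and U: "U \<in> H_space y K"
  shows "\<exists>V\<in>H_space y K. schrodinger_step \<tau> G U V"
proof -
  obtain c M where cM: "c > 0" "\<And>p. p \<in> I \<Longrightarrow> c \<le> cn_weight \<tau> p"
    "\<And>p. p \<in> I \<Longrightarrow> cn_weight \<tau> p \<le> M"
    using cn_weight_bounds[OF \<tau>] by metis
  obtain v where v: "v \<in> l2 I" "op.cn_step (cn_weight \<tau>)
      (\<lambda>p. of_real (\<mu> p) * zero_ext K G p) (zero_ext K U) v"
    using op.cn_step_exists[where d = "cn_weight \<tau>", OF cM(2,3,1) weighted_l2[OF G] H_l2[OF U]] by blast
  define V where "V j k = v (j, k)" for j k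
  have ext: "zero_ext K V = v" using l2_supp[OF v(1)] by (auto simp: zero_ext_def V_def fun_eq_iff)
  have zero: "zero_on_boundary K V"
    using l2_supp[OF v(1)] by (auto simp: zero_on_boundary_def V_def interior_nodes_def)
  have "V \<in> H_space y K" using l2_imp_H_space[of K V] v(1) ext zero by simp
  moreover have "schrodinger_step \<tau> G U V"
    unfolding schrodinger_step_iff[OF H_zero[OF U] zero] ext by (rule v(2))
  ultimately show ?thesis by blast
qed

lemma step_unique:
  assumes \<tau>: "\<tau> > 0" and U: "zero_on_boundary K U" and V: "V \<in> H_space y K" "V' \<in> H_space y K"
    and step: "schrodinger_step \<tau> G U V" "schrodinger_step \<tau> G U V'"
  shows "mesh_eq K V V'"
proof -
  obtain c M where cM: "c > 0" "\<And>p. p \<in> I \<Longrightarrow> c \<le> cn_weight \<tau> p"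
    "\<And>p. p \<in> I \<Longrightarrow> cn_weight \<tau> p \<le> M"
    using cn_weight_bounds[OF \<tau>] by metis
  have "zero_ext K V p = zero_ext K V' p" for p
    using op.cn_step_unique[where d = "cn_weight \<tau>", OF cM(2,3,1) H_l2[OF V(1)] H_l2[OF V(2)]] step
    unfolding schrodinger_step_iff[OF U H_zero[OF V(1)]] schrodinger_step_iff[OF U H_zero[OF V(2)]]
    by blast
  then show ?thesis
    unfolding mesh_eq_def by (metis zero_ext_node[OF H_zero[OF V(1)]] zero_ext_node[OF H_zero[OF V(2)]])
qed

lemma mass_nsq:
  assumes "U \<in> H_space y K"
  shows "(\<lambda>p. of_real (sqrt (\<mu> p) * sqrt (r p)) * zero_ext K U p) \<in> l2 I"
    and "mass U = sqrt (nsq (\<lambda>p. of_real (sqrt (\<mu> p) * sqrt (r p)) * zero_ext K U p))"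
proof -
  obtain c M where M: "c > 0" "\<And>p. p \<in> I \<Longrightarrow> c \<le> \<mu> p" "\<And>p. p \<in> I \<Longrightarrow> \<mu> p \<le> M"
    using \<mu>_bounds by metis
  obtain c' M' where M': "c' > 0" "\<And>p. p \<in> I \<Longrightarrow> c' \<le> r p" "\<And>p. p \<in> I \<Longrightarrow> r p \<le> M'"
    using r_bounds by metis
  have b: "sqrt (node_weight x y p) * \<bar>sqrt (cell_avg x y \<rho> (fst p) (snd p))\<bar> \<le> sqrt M * sqrt M'"
    if "p \<in> I" for p
  proof -
    have "sqrt (\<mu> p) * sqrt (r p) \<le> sqrt M * sqrt M'"
      using M(1) M'(1) M(2,3)[OF that] M'(2,3)[OF that]
      by (intro mult_mono real_sqrt_le_mono) auto
    then show ?thesis using r_pos[OF that] by (simp add: \<mu>_def r_def)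
  qed
  have w: "0 \<le> node_weight x y p" if "p \<in> I" for p using \<mu>_pos[OF that] by (simp add: \<mu>_def)
  note * = H_norm_scaled[where s = "\<lambda>j k. sqrt (cell_avg x y \<rho> j k)", OF H_l2[OF assms] w b]
  show "(\<lambda>p. of_real (sqrt (\<mu> p) * sqrt (r p)) * zero_ext K U p) \<in> l2 I"
    using *(1) by (simp add: \<mu>_def r_def)
  show "mass U = sqrt (nsq (\<lambda>p. of_real (sqrt (\<mu> p) * sqrt (r p)) * zero_ext K U p))"
    using *(2) by (simp add: \<mu>_def r_def mass_def)
qed

lemma force_nsq:
  assumes "G \<in> H_space y K"
  shows "(\<lambda>p. of_real (sqrt (\<mu> p) * inverse (sqrt (r p))) * zero_ext K G p) \<in> l2 I"
    and "force G = sqrt (nsq (\<lambda>p. of_real (sqrt (\<mu> p) * inverse (sqrt (r p))) * zero_ext K G p))"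
proof -
  obtain c M where c: "c > 0" "\<And>p. p \<in> I \<Longrightarrow> c \<le> \<mu> p" "\<And>p. p \<in> I \<Longrightarrow> \<mu> p \<le> M" using \<mu>_bounds by metis
  obtain c' M' where c': "c' > 0" "\<And>p. p \<in> I \<Longrightarrow> c' \<le> r p" "\<And>p. p \<in> I \<Longrightarrow> r p \<le> M'" using r_bounds by metis
  have b: "sqrt (node_weight x y p) * \<bar>inverse (sqrt (cell_avg x y \<rho> (fst p) (snd p)))\<bar>
      \<le> sqrt M * inverse (sqrt c')" if "p \<in> I" for p
  proof -
    have "sqrt (\<mu> p) * inverse (sqrt (r p)) \<le> sqrt M * inverse (sqrt c')"
      using c(1) c'(1) c(2,3)[OF that] c'(2)[OF that]
      by (intro mult_mono le_imp_inverse_le real_sqrt_le_mono) auto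
    then show ?thesis using r_pos[OF that] by (simp add: \<mu>_def r_def)
  qed
  have w: "0 \<le> node_weight x y p" if "p \<in> I" for p using \<mu>_pos[OF that] by (simp add: \<mu>_def)
  note * = H_norm_scaled[where s = "\<lambda>j k. inverse (sqrt (cell_avg x y \<rho> j k))", OF H_l2[OF assms] w b]
  show "(\<lambda>p. of_real (sqrt (\<mu> p) * inverse (sqrt (r p))) * zero_ext K G p) \<in> l2 I"
    using *(1) by (simp add: \<mu>_def r_def)
  show "force G = sqrt (nsq (\<lambda>p. of_real (sqrt (\<mu> p) * inverse (sqrt (r p))) * zero_ext K G p))"
    using *(2) by (simp add: \<mu>_def r_def force_def)
qed

lemma mass_nonneg: "U \<in> H_space y K \<Longrightarrow> 0 \<le> mass U"
  by (simp add: mass_nsq(2) nsq_nonneg)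

lemma force_nonneg: "G \<in> H_space y K \<Longrightarrow> 0 \<le> force G"
  by (simp add: force_nsq(2) nsq_nonneg)

lemma mass_sq:
  assumes "U \<in> H_space y K"
  shows "(\<Sum>\<^sub>\<infinity>p. cn_weight \<tau> p * (cmod (zero_ext K U p))\<^sup>2) = hbar / \<tau> * (mass U)\<^sup>2"
proof -
  have "(cmod (of_real (sqrt (\<mu> p) * sqrt (r p)) * zero_ext K U p))\<^sup>2
      = \<mu> p * r p * (cmod (zero_ext K U p))\<^sup>2" for p
  proof (cases "p \<in> I")
    case True
    then show ?thesis using \<mu>_pos[of p] r_pos[of p]
      by (simp add: norm_mult power_mult_distrib)
  qed (simp add: zero_ext_def)
  then have "(mass U)\<^sup>2 = (\<Sum>\<^sub>\<infinity>p. \<mu> p * r p * (cmod (zero_ext K U p))\<^sup>2)"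
    unfolding mass_nsq(2)[OF assms] by (simp add: nsq_nonneg) (simp add: nsq_def)
  then show ?thesis by (simp add: infsum_cmult_right'[symmetric] cn_weight_def mult.assoc del: times_divide_eq_left)
qed

text \<open>
  Cauchy-Schwarz, with \<mu> split as sqrt (\<mu> / \<rho>) times sqrt (\<mu> \<rho>).
\<close>

lemma work_bound:
  assumes G: "G \<in> H_space y K" and U: "U \<in> H_space y K"
  shows "Im (ip (\<lambda>p. of_real (\<mu> p) * zero_ext K G p) (zero_ext K U)) \<le> force G * mass U"
proof -
  let ?f = "\<lambda>p. of_real (\<mu> p) * zero_ext K G p"
  let ?g = "\<lambda>p. of_real (sqrt (\<mu> p) * inverse (sqrt (r p))) * zero_ext K G p"
  let ?u = "\<lambda>p. of_real (sqrt (\<mu> p) * sqrt (r p)) * zero_ext K U p"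
  have eq: "cmod (?f p * cnj (zero_ext K U p)) = cmod (?g p) * cmod (?u p)" for p
  proof (cases "p \<in> I")
    case True
    have "sqrt (\<mu> p) * inverse (sqrt (r p)) * (sqrt (\<mu> p) * sqrt (r p)) = \<mu> p"
      using \<mu>_pos[OF True] r_pos[OF True] by (simp add: field_simps)
    then have "cmod (?g p) * cmod (?u p) = \<mu> p * cmod (zero_ext K G p) * cmod (zero_ext K U p)"
      unfolding norm_mult norm_of_real using \<mu>_pos[OF True] r_pos[OF True]
      by (simp add: mult_ac)
    moreover have "cmod (?f p * cnj (zero_ext K U p))
        = \<mu> p * cmod (zero_ext K G p) * cmod (zero_ext K U p)"
      using \<mu>_pos[OF True] by (simp add: norm_mult)
    ultimately show ?thesis by simp
  qed (simp add: zero_ext_def)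
  have "Im (ip ?f (zero_ext K U)) \<le> cmod (ip ?f (zero_ext K U))"
    using abs_Im_le_cmod abs_le_D1 by blast
  also have "\<dots> \<le> (\<Sum>\<^sub>\<infinity>p. cmod (?f p * cnj (zero_ext K U p)))"
    unfolding ip_def using ip_summable(1)[OF weighted_l2[OF G] H_l2[OF U]]
    by (intro norm_infsum_bound) (simp add: norm_mult)
  also have "\<dots> = (\<Sum>\<^sub>\<infinity>p. cmod (?g p) * cmod (?u p))" by (simp only: eq)
  also have "\<dots> \<le> force G * mass U"
    unfolding force_nsq(2)[OF G] mass_nsq(2)[OF U]
    by (rule sum_le_nsq_product[OF force_nsq(1)[OF G] mass_nsq(1)[OF U]])
  finally show ?thesis .
qed

lemma step_energy:
  assumes \<tau>: "\<tau> > 0" and G: "G \<in> H_space y K" and U: "U \<in> H_space y K" and V: "V \<in> H_space y K"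
    and step: "schrodinger_step \<tau> G U V"
  shows "hbar / \<tau> * ((mass V)\<^sup>2 - (mass U)\<^sup>2)
    = Im (ip (\<lambda>p. of_real (\<mu> p) * zero_ext K G p) (zero_ext K V))
      + Im (ip (\<lambda>p. of_real (\<mu> p) * zero_ext K G p) (zero_ext K U))"
proof -
  obtain c M where cM: "c > 0" "\<And>p. p \<in> I \<Longrightarrow> c \<le> cn_weight \<tau> p"
    "\<And>p. p \<in> I \<Longrightarrow> cn_weight \<tau> p \<le> M"
    using cn_weight_bounds[OF \<tau>] by metis
  have d: "\<bar>cn_weight \<tau> p\<bar> \<le> M" if "p \<in> I" for p
    using cM(1) cM(2,3)[OF that] by linarith
  show ?thesis
    using op.cn_step_energy[where d = "cn_weight \<tau>", OF d weighted_l2[OF G] H_l2[OF U] H_l2[OF V]] step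
    unfolding schrodinger_step_iff[OF H_zero[OF U] H_zero[OF V]] mass_sq[OF U] mass_sq[OF V]
    by (simp add: right_diff_distrib)
qed

text \<open>
  Dividing the energy identity by the sum of the two norms makes the bound linear in the force; if
  that sum is 0, nothing can be divided, but then the bound is trivial.
\<close>

lemma step_stable:
  assumes \<tau>: "\<tau> > 0" and G: "G \<in> H_space y K" and U: "U \<in> H_space y K" and V: "V \<in> H_space y K"
    and step: "schrodinger_step \<tau> G U V"
  shows "mass V \<le> mass U + \<tau> / hbar * force G"
proof (cases "mass V + mass U = 0")
  case True
  then show ?thesis
    using mass_nonneg[OF U] mass_nonneg[OF V]
      mult_nonneg_nonneg[of "\<tau> / hbar", OF _ force_nonneg[OF G]] \<tau> hbar by auto
next
  case False
  then have pos: "mass V + mass U > 0" using mass_nonneg[OF U] mass_nonneg[OF V] by linarith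
  have "hbar / \<tau> * (mass V - mass U) * (mass V + mass U) = hbar / \<tau> * ((mass V)\<^sup>2 - (mass U)\<^sup>2)"
    by (simp add: power2_eq_square algebra_simps)
  also have "\<dots> \<le> force G * (mass V + mass U)"
    unfolding step_energy[OF assms] using work_bound[OF G U] work_bound[OF G V]
    by (simp add: distrib_left)
  finally have "hbar / \<tau> * (mass V - mass U) \<le> force G" by (rule mult_right_le_imp_le[OF _ pos])
  then show ?thesis using \<tau> hbar by (simp add: field_simps)
qed

lemma step_conserves:
  assumes \<tau>: "\<tau> > 0" and G: "G \<in> H_space y K" and U: "U \<in> H_space y K" and V: "V \<in> H_space y K"
    and step: "schrodinger_step \<tau> G U V" and zero: "mesh_eq K G (\<lambda>j k. 0)"
  shows "mass V = mass U"
proof -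
  have "zero_ext K G p = 0" for p
    using zero by (auto simp: zero_ext_def mesh_eq_def interior_nodes_def)
  then have "hbar / \<tau> * ((mass V)\<^sup>2 - (mass U)\<^sup>2) = 0"
    unfolding step_energy[OF \<tau> G U V step] by (simp add: ip_def)
  then have "(mass V)\<^sup>2 = (mass U)\<^sup>2" using \<tau> hbar by simp
  then show ?thesis using mass_nonneg[OF U] mass_nonneg[OF V] by simp
qed

end

section \<open>Marching in time\<close>

lemma norm_propag_rational: "cmod (propag_rational hbar t r dV m j k) = 1"
proof -
  define a where "a = step t m / (4 * hbar * r j k) * dV j k"
  have "cmod (1 - \<i> * of_real a) = cmod (1 + \<i> * of_real a)"
    by (simp add: cmod_def)
  moreover have "1 + \<i> * of_real a \<noteq> 0" by (simp add: complex_eq_iff)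
  ultimately show ?thesis
    unfolding propag_rational_def a_def[symmetric] norm_divide by simp
qed

lemma norm_propag_exp: "cmod (propag_exp hbar t r dV m j k) = 1"
  by (simp add: propag_exp_def)

lemma zero_on_boundary_mult: "zero_on_boundary K W \<Longrightarrow> zero_on_boundary K (\<lambda>j k. e j k * W j k)"
  by (simp add: zero_on_boundary_def)

lemma mesh_eqI:
  assumes "zero_on_boundary K U" "zero_on_boundary K W"
    and "\<And>j k. j \<ge> 1 \<Longrightarrow> k \<in> {1..<K} \<Longrightarrow> U j k = W j k"
  shows "mesh_eq K U W"
  unfolding mesh_eq_def
proof (intro allI impI)
  fix j k :: nat assume "k \<le> K"
  show "U j k = W j k"
  proof (cases "j = 0 \<or> k = 0 \<or> k = K")
    case True
    then show ?thesis using assms(1,2) \<open>k \<le> K\<close> unfolding zero_on_boundary_def by metis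
  next
    case False
    then show ?thesis using assms(3)[of j k] \<open>k \<le> K\<close> by auto
  qed
qed

context mesh_data
begin

lemma mass_cong:
  assumes "\<And>j k. j \<ge> 1 \<Longrightarrow> k \<in> {1..<K} \<Longrightarrow> cmod (U j k) = cmod (W j k)"
  shows "mass U = mass W"
  unfolding mass_def by (rule H_norm_cong) (simp add: assms)

text \<open>
  The time stepping depends on the propagator E only through its modulus, so both admissible choices
  are covered at once.
\<close>

context
  fixes t :: "nat \<Rightarrow> real" and E F :: "nat \<Rightarrow> nat \<Rightarrow> nat \<Rightarrow> complex" and \<Psi>h :: "nat \<Rightarrow> nat \<Rightarrow> complex"
  assumes t: "strict_mono t" and E_unimodular: "\<forall>m j k. cmod (E m j k) = 1"
    and F_mem: "\<forall>m\<ge>1. F m \<in> H_space y K" and \<Psi>h: "\<Psi>h \<in> H_space y K"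
begin

lemmas norm_E = E_unimodular[rule_format]
lemmas F_H = F_mem[rule_format]

definition solves where
  "solves \<Psi>b \<Psi>t \<Psi> \<longleftrightarrow> scheme_solution hbar \<rho> B Vt t x y K E F \<Psi>h \<Psi>b \<Psi>t \<Psi> \<and> (\<forall>m. \<Psi> m \<in> H_space y K)"

lemma step_t_pos: "m \<ge> 1 \<Longrightarrow> step t m > 0"
  using t by (simp add: step_def strict_mono_less)

lemma solves_start: "solves \<Psi>b \<Psi>t \<Psi> \<Longrightarrow> mesh_eq K (\<Psi> 0) \<Psi>h"
  by (simp add: solves_def scheme_solution_def)

lemma solves_mem: "solves \<Psi>b \<Psi>t \<Psi> \<Longrightarrow> \<Psi> m \<in> H_space y K"
  by (simp add: solves_def)

lemma solves_boundary:
  assumes "solves \<Psi>b \<Psi>t \<Psi>" "m \<ge> 1"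
  shows "zero_on_boundary K (\<Psi>b m)" "zero_on_boundary K (\<Psi>t m)"
  using assms by (auto simp: solves_def scheme_solution_def)

lemma solves_potential:
  assumes "solves \<Psi>b \<Psi>t \<Psi>" "m \<ge> 1" "j \<ge> 1" "k \<in> {1..<K}"
  shows "\<Psi>b m j k = E m j k * \<Psi> (m - 1) j k" "\<Psi> m j k = E m j k * \<Psi>t m j k"
  using assms unfolding solves_def scheme_solution_def by blast+

lemma solves_step:
  assumes "solves \<Psi>b \<Psi>t \<Psi>" "m \<ge> 1"
  shows "schrodinger_step (step t m) (F m) (\<Psi>b m) (\<Psi>t m)"
  using assms unfolding solves_def scheme_solution_def schrodinger_step_def by blast

text \<open>
  The potential stages preserve moduli at each node. Hence the intermediate functions inherit
  membership in the space from the functions at full time levels, which is what makes uniqueness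
  of the middle stage applicable to an arbitrary solution.
\<close>

lemma solves_intermediate:
  assumes s: "solves \<Psi>b \<Psi>t \<Psi>" and m: "m \<ge> 1"
  shows "\<Psi>b m \<in> H_space y K" "\<Psi>t m \<in> H_space y K"
    "mass (\<Psi>b m) = mass (\<Psi> (m - 1))" "mass (\<Psi> m) = mass (\<Psi>t m)"
proof -
  have b: "cmod (\<Psi>b m j k) = cmod (\<Psi> (m - 1) j k)" "cmod (\<Psi>t m j k) = cmod (\<Psi> m j k)"
    if "j \<ge> 1" "k \<in> {1..<K}" for j k
    using solves_potential[OF s m that] norm_E[of m j k] by (simp_all add: norm_mult)
  show "\<Psi>b m \<in> H_space y K"
    by (rule H_space_modulus[OF solves_mem[OF s] solves_boundary(1)[OF s m] b(1)])
  show "\<Psi>t m \<in> H_space y K"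
    by (rule H_space_modulus[OF solves_mem[OF s] solves_boundary(2)[OF s m] b(2)])
  show "mass (\<Psi>b m) = mass (\<Psi> (m - 1))" "mass (\<Psi> m) = mass (\<Psi>t m)"
    by (intro mass_cong; simp add: b)+
qed

lemma solution_exists: "\<exists>\<Psi>b \<Psi>t \<Psi>. solves \<Psi>b \<Psi>t \<Psi>"
proof -
  \<comment> \<open>A solution operator of the middle stage; recursion on the time level then builds the scheme.\<close>
  define kinetic where "kinetic m U = (SOME V. V \<in> H_space y K \<and> schrodinger_step (step t m) (F m) U V)" for m U
  have kinetic: "kinetic m U \<in> H_space y K" "schrodinger_step (step t m) (F m) U (kinetic m U)"
    if "m \<ge> 1" "U \<in> H_space y K" for m U
    using someI_ex[of "\<lambda>V. V \<in> H_space y K \<and> schrodinger_step (step t m) (F m) U V"]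
      step_exists[OF step_t_pos[OF that(1)] F_H[OF that(1)] that(2)] unfolding kinetic_def by blast+
  have phase: "(\<lambda>j k. E m j k * W j k) \<in> H_space y K" if "W \<in> H_space y K" for m W
    using that by (rule H_space_modulus) (auto simp: norm_mult norm_E zero_on_boundary_mult H_zero that)
  define \<Psi> where "\<Psi> = rec_nat \<Psi>h (\<lambda>m U. \<lambda>j k. E (Suc m) j k * kinetic (Suc m) (\<lambda>j k. E (Suc m) j k * U j k) j k)"
  define \<Psi>b where "\<Psi>b m = (\<lambda>j k. E m j k * \<Psi> (m - 1) j k)" for m
  define \<Psi>t where "\<Psi>t m = kinetic m (\<Psi>b m)" for m
  have \<Psi>S: "\<Psi> m = (\<lambda>j k. E m j k * \<Psi>t m j k)" if "m \<ge> 1" for m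
    using that by (cases m) (simp_all add: \<Psi>_def \<Psi>t_def \<Psi>b_def)
  have \<Psi>b: "\<Psi>b m \<in> H_space y K" if "\<Psi> (m - 1) \<in> H_space y K" for m
    unfolding \<Psi>b_def using that by (rule phase)
  have \<Psi>: "\<Psi> m \<in> H_space y K" for m
  proof (induction m)
    case (Suc m)
    then show ?case using kinetic(1)[of "Suc m"] \<Psi>b[of "Suc m"]
      by (simp add: \<Psi>S \<Psi>t_def phase)
  qed (simp add: \<Psi>_def \<Psi>h)
  have \<Psi>t: "\<Psi>t m \<in> H_space y K" "schrodinger_step (step t m) (F m) (\<Psi>b m) (\<Psi>t m)" if "m \<ge> 1" for m
    unfolding \<Psi>t_def using kinetic[OF that \<Psi>b[OF \<Psi>]] by auto
  have "mesh_eq K (\<Psi> 0) \<Psi>h" by (simp add: \<Psi>_def mesh_eq_def)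
  then have "scheme_solution hbar \<rho> B Vt t x y K E F \<Psi>h \<Psi>b \<Psi>t \<Psi>"
    unfolding scheme_solution_def using H_zero[OF \<Psi>] H_zero[OF \<Psi>b[OF \<Psi>]] H_zero[OF \<Psi>t(1)] \<Psi>t(2)
    unfolding schrodinger_step_def by (simp add: \<Psi>b_def \<Psi>S zero_on_boundary_mult)
  then show ?thesis using \<Psi> unfolding solves_def by blast
qed

lemma solution_unique:
  assumes s: "solves \<Psi>b \<Psi>t \<Psi>" and s': "solves \<Psi>b' \<Psi>t' \<Psi>'"
  shows "mesh_eq K (\<Psi>' m) (\<Psi> m)" "m \<ge> 1 \<Longrightarrow> mesh_eq K (\<Psi>b' m) (\<Psi>b m) \<and> mesh_eq K (\<Psi>t' m) (\<Psi>t m)"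
proof -
  have step: "mesh_eq K (\<Psi>b' m) (\<Psi>b m) \<and> mesh_eq K (\<Psi>t' m) (\<Psi>t m) \<and> mesh_eq K (\<Psi>' m) (\<Psi> m)"
    if m: "m \<ge> 1" and prev: "mesh_eq K (\<Psi>' (m - 1)) (\<Psi> (m - 1))" for m
  proof -
    have b: "mesh_eq K (\<Psi>b' m) (\<Psi>b m)"
      using prev by (intro mesh_eqI solves_boundary[OF s m] solves_boundary[OF s' m])
        (simp add: solves_potential[OF s m] solves_potential[OF s' m] mesh_eq_def)
    have "zero_ext K (\<Psi>b' m) = zero_ext K (\<Psi>b m)"
      using b by (auto simp: mesh_eq_def zero_ext_def interior_nodes_def fun_eq_iff)
    then have "schrodinger_step (step t m) (F m) (\<Psi>b m) (\<Psi>t' m)"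
      using solves_step[OF s' m]
      unfolding schrodinger_step_iff[OF solves_boundary(1)[OF s' m] solves_boundary(2)[OF s' m]]
        schrodinger_step_iff[OF solves_boundary(1)[OF s m] solves_boundary(2)[OF s' m]] by simp
    then have t: "mesh_eq K (\<Psi>t' m) (\<Psi>t m)"
      by (rule step_unique[OF step_t_pos[OF m] solves_boundary(1)[OF s m] solves_intermediate(2)[OF s' m]
            solves_intermediate(2)[OF s m] _ solves_step[OF s m]])
    then have "mesh_eq K (\<Psi>' m) (\<Psi> m)"
      by (intro mesh_eqI H_zero solves_mem[OF s] solves_mem[OF s'])
        (simp add: solves_potential[OF s m] solves_potential[OF s' m] mesh_eq_def)
    then show ?thesis using b t by simp
  qed
  have eq: "mesh_eq K (\<Psi>' m) (\<Psi> m)" for m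
  proof (induction m)
    case 0
    show ?case using solves_start[OF s] solves_start[OF s'] by (simp add: mesh_eq_def)
  next
    case (Suc m)
    then show ?case using step[of "Suc m"] by simp
  qed
  then show "mesh_eq K (\<Psi>' m) (\<Psi> m)" .
  show "mesh_eq K (\<Psi>b' m) (\<Psi>b m) \<and> mesh_eq K (\<Psi>t' m) (\<Psi>t m)" if "m \<ge> 1"
    using step[OF that eq] by simp
qed

lemma mass_start:
  assumes "solves \<Psi>b \<Psi>t \<Psi>"
  shows "mass (\<Psi> 0) = mass \<Psi>h"
  by (rule mass_cong) (use solves_start[OF assms] in \<open>simp add: mesh_eq_def\<close>)

lemma mass_growth:
  assumes s: "solves \<Psi>b \<Psi>t \<Psi>"
  shows "mass (\<Psi> m) \<le> mass \<Psi>h + 1 / hbar * (\<Sum>n = 1..m. force (F n) * step t n)"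
proof (induction m)
  case (Suc m)
  have m: "Suc m \<ge> 1" by simp
  have "mass (\<Psi> (Suc m)) \<le> mass (\<Psi> m) + step t (Suc m) / hbar * force (F (Suc m))"
    using step_stable[OF step_t_pos[OF m] F_H[OF m] solves_intermediate(1,2)[OF s m] solves_step[OF s m]]
    by (simp add: solves_intermediate(3,4)[OF s m])
  then show ?case using Suc by (simp add: algebra_simps add_divide_distrib)
qed (simp add: mass_start[OF s])

lemma mass_conserved:
  assumes s: "solves \<Psi>b \<Psi>t \<Psi>" and zero: "\<And>m. m \<ge> 1 \<Longrightarrow> mesh_eq K (F m) (\<lambda>j k. 0)"
  shows "mass (\<Psi> m) = mass \<Psi>h"
proof (induction m)
  case (Suc m)
  have m: "Suc m \<ge> 1" by simp
  show ?case
    using step_conserves[OF step_t_pos[OF m] F_H[OF m] solves_intermediate(1,2)[OF s m]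
        solves_step[OF s m] zero[OF m]] Suc
    by (simp add: solves_intermediate(3,4)[OF s m])
qed (simp add: mass_start[OF s])

lemma max_mass_bound:
  assumes s: "solves \<Psi>b \<Psi>t \<Psi>"
  shows "(MAX m\<in>{0..M}. mass (\<Psi> m)) \<le> mass \<Psi>h + 2 / hbar * (\<Sum>m = 1..M. force (F m) * step t m)"
proof (rule Max.boundedI)
  fix a assume "a \<in> (\<lambda>m. mass (\<Psi> m)) ` {0..M}"
  then obtain m where m: "m \<le> M" "a = mass (\<Psi> m)" by auto
  have nonneg: "0 \<le> force (F n) * step t n" if "n \<ge> 1" for n
    using force_nonneg[OF F_H[OF that]] step_t_pos[OF that] by simp
  have "(\<Sum>n = 1..m. force (F n) * step t n) \<le> (\<Sum>n = 1..M. force (F n) * step t n)"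
    using m by (intro sum_mono2 nonneg) auto
  moreover have "0 \<le> (\<Sum>n = 1..M. force (F n) * step t n)" by (intro sum_nonneg nonneg) auto
  ultimately have "1 / hbar * (\<Sum>n = 1..m. force (F n) * step t n)
      \<le> 2 / hbar * (\<Sum>n = 1..M. force (F n) * step t n)"
    using hbar by (simp add: field_simps)
  then show "a \<le> mass \<Psi>h + 2 / hbar * (\<Sum>m = 1..M. force (F m) * step t m)"
    using mass_growth[OF s, of m] m by simp
qed auto

end

end

section \<open>Coefficients that are constant far away\<close>

text \<open>
  Such a function takes only finitely many values on the strip.
\<close>

lemma eventually_constant_bounded:
  fixes f :: "nat \<times> nat \<Rightarrow> real"
  assumes "\<And>j k. j \<ge> N \<Longrightarrow> k < K \<Longrightarrow> f (j, k) = f (N, k)"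
  shows "\<exists>M. \<forall>j. \<forall>k<K. \<bar>f (j, k)\<bar> \<le> M"
proof (intro exI allI impI)
  fix j k assume k: "k < K"
  have "f (j, k) = f (min j N, k)" using assms[of j k] k by (cases "j \<ge> N") (auto simp: min_def)
  then show "\<bar>f (j, k)\<bar> \<le> Max ((\<lambda>p. \<bar>f p\<bar>) ` ({..N} \<times> {..<K}))"
    using k by (auto intro!: Max_ge)
qed

lemma eventually_constant_pos_bounds:
  fixes f :: "nat \<times> nat \<Rightarrow> real"
  assumes const: "\<And>j k. j \<ge> N \<Longrightarrow> k \<in> {1..<K} \<Longrightarrow> f (j, k) = f (N, k)" and N: "N \<ge> 1"
    and pos: "\<And>p. p \<in> interior_nodes K \<Longrightarrow> f p > 0"
  shows "\<exists>c>0. \<exists>M. \<forall>p\<in>interior_nodes K. c \<le> f p \<and> f p \<le> M"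
proof -
  define S where "S = insert 1 (f ` ({1..N} \<times> {1..<K}))"
  have fin: "finite S" "S \<noteq> {}" by (auto simp: S_def)
  have "f p \<in> S" if p_in: "p \<in> interior_nodes K" for p
  proof -
    obtain j k where p: "p = (j, k)" "j \<ge> 1" "k \<in> {1..<K}" using p_in by (cases p) (auto simp: interior_nodes_def)
    have "f p = f (min j N, k)" using const[of j k] p by (cases "j \<ge> N") (auto simp: min_def)
    then show ?thesis using p N by (auto simp: S_def)
  qed
  moreover have "Min S > 0"
    using fin pos N by (auto simp: S_def interior_nodes_def)
  ultimately show ?thesis using fin by (intro exI[of _ "Min S"] conjI exI[of _ "Max S"] ballI) auto
qed

lemma fwd_avg_pos:
  fixes w :: "nat \<Rightarrow> real"
  assumes "step s j > 0" "step s (Suc j) > 0" "w j > 0" "w (Suc j) > 0"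
  shows "fwd_avg s w j > 0"
  using assms by (simp add: fwd_avg_def half_step_def add_pos_pos)

text \<open>
  From the column J on the steps are equal, and the cells used there lie to the right of x (J - 2),
  where the coefficients are constant. So all bounds reduce to finitely many values, and
  positivity at each node is enough for a positive lower bound.
\<close>

lemma mesh_data_far_constant:
  fixes x y :: "nat \<Rightarrow> real" and B :: "real \<times> real \<Rightarrow> real^2^2"
  assumes hbar: "hbar > 0"
    and rho: "\<rho>low > 0" "\<forall>z\<in>strip Y. \<rho> z \<ge> \<rho>low"
    and B_sym: "\<forall>z\<in>strip Y. transpose (B z) = B z"
    and far: "\<forall>z\<in>strip Y - strip_upto X\<^sub>0 Y.
        B z $ 1 $ 1 = B1inf \<and> B z $ 1 $ 2 = 0 \<and> B z $ 2 $ 1 = 0 \<and> B z $ 2 $ 2 = B2inf \<and>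
        \<rho> z = \<rho>inf \<and> V z = Vinf"
    and Vt_far: "\<forall>a\<ge>X\<^sub>0. Vt a = Vinf"
    and x_mesh: "x 0 = 0" "strict_mono x" "J \<ge> 2" "x (J - 2) \<ge> X\<^sub>0" "\<forall>j\<ge>J. step x j = step x J"
    and y_mesh: "y 0 = 0" "\<forall>k<K. y k < y (Suc k)" "y K = Y"
  shows "mesh_data hbar x y K \<rho> B Vt"
proof -
  have step_x: "step x (Suc j) > 0" for j using x_mesh(2) by (simp add: step_def strict_mono_less)
  have step_y: "step y (Suc k) > 0" if "k < K" for k using y_mesh(2) that by (simp add: step_def)
  have y_mono: "y k \<le> y l" if "k \<le> l" "l \<le> K" for k l
    using that
  proof (induction l rule: dec_induct)
    case (step n)
    then show ?case using y_mesh(2) by (force dest: spec[of _ n])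
  qed simp
  \<comment> \<open>Midpoint of the cell (j, k) in 0-based numbering.\<close>
  define z where "z j k = ((x j + x (Suc j)) / 2, (y k + y (Suc k)) / 2)" for j k
  have mid: "cell_mid x y A (Suc j) (Suc k) = A (z j k)" for A j k by (simp add: cell_mid_def z_def)
  have strip: "z j k \<in> strip Y" if "k < K" for j k
  proof -
    have "x 0 \<le> x j" "x j < x (Suc j)" using x_mesh(2) by (auto simp: strict_mono_less strict_mono_less_eq)
    moreover have "y 0 \<le> y k" "y k < y (Suc k)" "y (Suc k) \<le> y K" using that y_mesh(2) by (auto intro!: y_mono)
    ultimately show ?thesis using x_mesh(1) y_mesh(1,3) by (auto simp: strip_def z_def)
  qed
  have x_far: "X\<^sub>0 \<le> (x j + x (Suc j)) / 2" if "Suc j \<ge> J" for j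
  proof -
    have "x (J - 2) \<le> x j" "x j < x (Suc j)"
      using that x_mesh(2) by (auto simp: strict_mono_less strict_mono_less_eq)
    then show ?thesis using x_mesh(4) by simp
  qed
  have zfar: "z j k \<in> strip Y - strip_upto X\<^sub>0 Y" if "Suc j \<ge> J" "k < K" for j k
    using strip[OF that(2)] x_far[OF that(1)] by (auto simp: strip_upto_def z_def)
  have far': "B (z j k) $ 1 $ 1 = B1inf" "B (z j k) $ 1 $ 2 = 0" "B (z j k) $ 2 $ 1 = 0"
    "B (z j k) $ 2 $ 2 = B2inf" "\<rho> (z j k) = \<rho>inf" if "Suc j \<ge> J" "k < K" for j k
    using far zfar[OF that] by auto
  have hx: "step x j = step x J" if "j \<ge> J" for j using x_mesh(5) that by blast
  have half_y: "half_step y k > 0" if "k \<in> {1..<K}" for k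
    using step_y[of "k - 1"] step_y[of k] that by (cases k) (auto simp: half_step_def)
  have half_x: "half_step x j > 0" if "j \<ge> 1" for j
    using step_x[of "j - 1"] step_x[of j] that by (simp add: half_step_def)
  show ?thesis
  proof
    show "hbar > 0" by (rule hbar)
    show "step x (Suc j) > 0" for j by (rule step_x)
    show "step y (Suc k) > 0" if "k < K" for k by (rule step_y[OF that])
    show "\<exists>c>0. \<exists>M. \<forall>p\<in>interior_nodes K. c \<le> node_weight x y p \<and> node_weight x y p \<le> M"
    proof (rule eventually_constant_pos_bounds[where N = J])
      show "node_weight x y (j, k) = node_weight x y (J, k)" if "j \<ge> J" for j k
        using hx[OF that] hx[of "Suc j"] hx[of "Suc J"] that by (simp add: node_weight_def half_step_def)
      show "node_weight x y p > 0" if "p \<in> interior_nodes K" for p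
        using that half_x half_y by (auto simp: node_weight_def interior_nodes_def)
    qed (use x_mesh(3) in auto)
    have avg: "cell_avg x y \<rho> (Suc j) (Suc k) = fwd_avg x (\<lambda>i. fwd_avg y (\<lambda>l. cell_mid x y \<rho> i l) (Suc k)) (Suc j)" for j k
      by (simp add: cell_avg_def in_x_def in_y_def)
    show "\<exists>c>0. \<exists>M. \<forall>p\<in>interior_nodes K.
      c \<le> cell_avg x y \<rho> (fst p) (snd p) \<and> cell_avg x y \<rho> (fst p) (snd p) \<le> M"
    proof (rule eventually_constant_pos_bounds[where N = J])
      show "cell_avg x y \<rho> (fst (j, k)) (snd (j, k)) = cell_avg x y \<rho> (fst (J, k)) (snd (J, k))"
        if jk: "j \<ge> J" "k \<in> {1..<K}" for j k
      proof -
        obtain j' J' k' where eq: "j = Suc j'" "J = Suc J'" "k = Suc k'"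
          using jk x_mesh(3) by (cases j; cases J; cases k) auto
        show ?thesis using jk hx[of j] hx[of "Suc j"] hx[of "Suc J"]
          by (simp add: eq avg fwd_avg_def half_step_def mid far')
      qed
      have pos: "\<rho> (z j k) > 0" if "k < K" for j k using rho strip[OF that, of j] by force
      show "cell_avg x y \<rho> (fst p) (snd p) > 0" if p: "p \<in> interior_nodes K" for p
      proof -
        obtain j k where eq: "p = (Suc j, Suc k)" and k: "Suc k < K"
          using p by (cases p; cases "fst p"; cases "snd p") (auto simp: interior_nodes_def)
        show ?thesis unfolding eq fst_conv snd_conv avg
          by (intro fwd_avg_pos step_x step_y) (use k in \<open>auto simp: mid intro!: pos\<close>)
      qed
    qed (use x_mesh(3) in auto)
    have "\<exists>M. \<forall>j. \<forall>k<K. \<bar>aux_pot x Vt (fst (j, k))\<bar> \<le> M"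
    proof (rule eventually_constant_bounded[where N = J])
      fix j k :: nat assume j: "j \<ge> J"
      have Vt_mid: "Vt ((x (i - 1) + x i) / 2) = Vinf" if "i \<ge> J" for i
        using that x_far[of "i - 1"] Vt_far x_mesh(3) by simp
      then show "aux_pot x Vt (fst (j, k)) = aux_pot x Vt (fst (J, k))"
        using j hx[of j] hx[of "Suc j"] hx[of "Suc J"] Vt_mid[of j] Vt_mid[of "Suc j"] Vt_mid[of J]
          Vt_mid[of "Suc J"] by (simp add: aux_pot_def fwd_avg_def half_step_def)
    qed
    then show "\<exists>M. \<forall>p\<in>interior_nodes K. \<bar>aux_pot x Vt (fst p)\<bar> \<le> M"
      by (auto simp: interior_nodes_def)
    have bound: "\<exists>M. \<forall>c. \<bar>cell_form hbar x y K B c \<alpha> \<beta>\<bar> \<le> M" for \<alpha> \<beta>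
    proof -
      have "\<exists>M. \<forall>j. \<forall>k<K. \<bar>cell_form hbar x y K B (j, k) \<alpha> \<beta>\<bar> \<le> M"
      proof (rule eventually_constant_bounded[where N = J])
        fix j k assume "j \<ge> J" "k < K"
        then show "cell_form hbar x y K B (j, k) \<alpha> \<beta> = cell_form hbar x y K B (J, k) \<alpha> \<beta>"
          using hx[of "Suc j"] hx[of "Suc J"] by (simp add: cell_form_def Let_def mid far')
      qed
      then obtain M where M: "\<And>j k. k < K \<Longrightarrow> \<bar>cell_form hbar x y K B (j, k) \<alpha> \<beta>\<bar> \<le> M" by blast
      have "\<bar>cell_form hbar x y K B c \<alpha> \<beta>\<bar> \<le> max M 0" for c
        using M[of "snd c" "fst c"] by (cases "snd c < K") (auto simp: cell_form_def)
      then show ?thesis by blast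
    qed
    then obtain M where M: "\<And>\<alpha> \<beta> c. \<bar>cell_form hbar x y K B c \<alpha> \<beta>\<bar> \<le> M \<alpha> \<beta>" by metis
    have "\<bar>cell_form hbar x y K B c \<alpha> \<beta>\<bar> \<le> Max (case_prod M ` (corners \<times> corners))"
      if "\<alpha> \<in> corners" "\<beta> \<in> corners" for c \<alpha> \<beta>
      using that by (intro order_trans[OF M[of c \<alpha> \<beta>]] Max_ge) (auto simp: finite_corners)
    then show "\<exists>M. \<forall>c. \<forall>\<alpha>\<in>corners. \<forall>\<beta>\<in>corners. \<bar>cell_form hbar x y K B c \<alpha> \<beta>\<bar> \<le> M" by blast
    show "cell_form hbar x y K B c \<alpha> \<beta> = cell_form hbar x y K B c \<beta> \<alpha>" for c \<alpha> \<beta>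
    proof (cases "snd c < K")
      case True
      then have "transpose (B (z (fst c) (snd c))) = B (z (fst c) (snd c))"
        by (intro bspec[OF B_sym] strip)
      then have "B (z (fst c) (snd c)) $ 1 $ 2 = B (z (fst c) (snd c)) $ 2 $ 1"
        by (auto simp: transpose_def dest: arg_cong[of _ _ "\<lambda>A. A $ 2 $ 1"])
      then show ?thesis by (auto simp: cell_form_def Let_def mid mult_ac add_ac)
    qed (simp add: cell_form_def)
  qed
qed

section \<open>The stability theorem\<close>

theorem proposition1:
  fixes hbar Y X\<^sub>0 X \<rho>low \<rho>inf Vinf B1inf B2inf :: real
    and \<rho> V :: "real \<times> real \<Rightarrow> real"
    and B :: "real \<times> real \<Rightarrow> real^2^2"
    and Vt :: "real \<Rightarrow> real"
    and t x y :: "nat \<Rightarrow> real"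
    and J K :: nat
    and E F :: "nat \<Rightarrow> nat \<Rightarrow> nat \<Rightarrow> complex"
    and \<Psi>h :: "nat \<Rightarrow> nat \<Rightarrow> complex"
  assumes hbar: "hbar > 0" and Y: "Y > 0" and X\<^sub>0: "X\<^sub>0 > 0"
    and rho: "\<rho>low > 0" "\<forall>z\<in>strip Y. \<rho> z \<ge> \<rho>low"
    and B_sym: "\<forall>z\<in>strip Y. transpose (B z) = B z"
    and B_posdef: "\<exists>\<nu>>0. \<forall>z\<in>strip Y. \<forall>\<xi>. \<xi> \<bullet> (B z *v \<xi>) \<ge> \<nu> * (norm \<xi>)\<^sup>2"
    and far_pos: "B1inf > 0" "B2inf > 0" "\<rho>inf > 0"
    and far: "\<forall>z\<in>strip Y - strip_upto X\<^sub>0 Y.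
        B z $ 1 $ 1 = B1inf \<and> B z $ 1 $ 2 = 0 \<and> B z $ 2 $ 1 = 0 \<and> B z $ 2 $ 2 = B2inf \<and>
        \<rho> z = \<rho>inf \<and> V z = Vinf"
    and Vt_far: "\<forall>a\<ge>X\<^sub>0. Vt a = Vinf"
    and t_mesh: "t 0 = 0" "strict_mono t" "filterlim t at_top sequentially"
    and x_mesh: "x 0 = 0" "strict_mono x" "x J = X" "X > X\<^sub>0" "J \<ge> 2" "x (J - 2) \<ge> X\<^sub>0"
        "\<forall>j\<ge>J. step x j = step x J"
    and y_mesh: "y 0 = 0" "\<forall>k<K. y k < y (Suc k)" "y K = Y"
    and E: "E = propag_rational hbar t (cell_avg x y \<rho>) (pot_diff x y V Vt) \<or>
            E = propag_exp hbar t (cell_avg x y \<rho>) (pot_diff x y V Vt)"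
    and F: "\<forall>m\<ge>1. F m \<in> H_space y K"
    and \<Psi>h: "\<Psi>h \<in> H_space y K"
  shows "\<exists>\<Psi>b \<Psi>t \<Psi>.
    scheme_solution hbar \<rho> B Vt t x y K E F \<Psi>h \<Psi>b \<Psi>t \<Psi> \<and>
    (\<forall>m. \<Psi> m \<in> H_space y K) \<and>
    (\<forall>\<Psi>b' \<Psi>t' \<Psi>'.
       scheme_solution hbar \<rho> B Vt t x y K E F \<Psi>h \<Psi>b' \<Psi>t' \<Psi>' \<and> (\<forall>m. \<Psi>' m \<in> H_space y K) \<longrightarrow>
       (\<forall>m. mesh_eq K (\<Psi>' m) (\<Psi> m)) \<and>
       (\<forall>m\<ge>1. mesh_eq K (\<Psi>b' m) (\<Psi>b m) \<and> mesh_eq K (\<Psi>t' m) (\<Psi>t m))) \<and>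
    (\<forall>M\<ge>1.
       (MAX m\<in>{0..M}. H_norm x y K (\<lambda>j k. sqrt (cell_avg x y \<rho> j k) *\<^sub>R \<Psi> m j k))
       \<le> H_norm x y K (\<lambda>j k. sqrt (cell_avg x y \<rho> j k) *\<^sub>R \<Psi>h j k)
         + 2 / hbar * (\<Sum>m = 1..M.
             H_norm x y K (\<lambda>j k. F m j k /\<^sub>R sqrt (cell_avg x y \<rho> j k)) * step t m)) \<and>
    ((\<forall>m\<ge>1. mesh_eq K (F m) (\<lambda>j k. 0)) \<longrightarrow>
     (\<forall>m\<ge>1.
       (H_norm x y K (\<lambda>j k. sqrt (cell_avg x y \<rho> j k) *\<^sub>R \<Psi> m j k))\<^sup>2
       = (H_norm x y K (\<lambda>j k. sqrt (cell_avg x y \<rho> j k) *\<^sub>R \<Psi>h j k))\<^sup>2))"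
proof -
  interpret mesh_data hbar x y K \<rho> B Vt
    by (rule mesh_data_far_constant[OF hbar rho B_sym far Vt_far x_mesh(1,2,5,6,7) y_mesh])
  have "\<forall>m j k. cmod (E m j k) = 1"
    using E by (auto simp: norm_propag_rational norm_propag_exp)
  note march = t_mesh(2) this F \<Psi>h
  obtain \<Psi>b \<Psi>t \<Psi> where s: "solves t E F \<Psi>h \<Psi>b \<Psi>t \<Psi>"
    using solution_exists[OF march] by blast
  show ?thesis
  proof (rule exI[of _ \<Psi>b], rule exI[of _ \<Psi>t], rule exI[of _ \<Psi>], intro conjI allI impI)
    show "scheme_solution hbar \<rho> B Vt t x y K E F \<Psi>h \<Psi>b \<Psi>t \<Psi>"
      using s unfolding solves_def[OF march] by blast
    show "\<Psi> m \<in> H_space y K" for m by (rule solves_mem[OF march s])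
    fix \<Psi>b' \<Psi>t' \<Psi>'
    assume "scheme_solution hbar \<rho> B Vt t x y K E F \<Psi>h \<Psi>b' \<Psi>t' \<Psi>' \<and> (\<forall>m. \<Psi>' m \<in> H_space y K)"
    then have s': "solves t E F \<Psi>h \<Psi>b' \<Psi>t' \<Psi>'" unfolding solves_def[OF march] .
    show "mesh_eq K (\<Psi>' m) (\<Psi> m)" for m by (rule solution_unique(1)[OF march s s'])
    show "mesh_eq K (\<Psi>b' m) (\<Psi>b m)" "mesh_eq K (\<Psi>t' m) (\<Psi>t m)" if "1 \<le> m" for m
      using solution_unique(2)[OF march s s' that] by auto
  next
    fix M :: nat assume "1 \<le> M"
    show "(MAX m\<in>{0..M}. H_norm x y K (\<lambda>j k. sqrt (cell_avg x y \<rho> j k) *\<^sub>R \<Psi> m j k))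
       \<le> H_norm x y K (\<lambda>j k. sqrt (cell_avg x y \<rho> j k) *\<^sub>R \<Psi>h j k)
         + 2 / hbar * (\<Sum>m = 1..M.
             H_norm x y K (\<lambda>j k. F m j k /\<^sub>R sqrt (cell_avg x y \<rho> j k)) * step t m)"
      using max_mass_bound[OF march s, of M] unfolding mass_def force_def .
  next
    fix m assume zero: "\<forall>m\<ge>1. mesh_eq K (F m) (\<lambda>j k. 0)"
    show "(H_norm x y K (\<lambda>j k. sqrt (cell_avg x y \<rho> j k) *\<^sub>R \<Psi> m j k))\<^sup>2
       = (H_norm x y K (\<lambda>j k. sqrt (cell_avg x y \<rho> j k) *\<^sub>R \<Psi>h j k))\<^sup>2"
      using mass_conserved[OF march s, of m] zero unfolding mass_def by simp
  qed
qed

end
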